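(* Let $(S_n)_{n\ge 0}$ be an ERWG process with any memory matrix $B$ (not necessarily diagonalisable), and suppose $\frac12<\eta<1$. Then there exist complex random variables $\xi_1,\dots,\xi_s$ such that $$\frac{S_n}{n^\eta(\log n)^{\nu-1}}-\sum_{t:\ \Re(\lambda_t)=\eta,\ \nu_t=\nu}e^{i\,\Im(\lambda_t)\log n}\,\xi_t\,\mathbf{e}_t\mathbf{T}^{-1}\xrightarrow{a.s.}0,$$ where $i=\sqrt{-1}$ and $\mathbf{e}_t$ is the $k$-dimensional row vector whose $\big(\sum_{j=1}^t\nu_j\big)$-th entry is $1$ and all other entries are $0$.
   Context: ERWG model. Let $k\ge1$, $V=\{1,\dots,k\}$, and let $(V,\overrightarrow{E})$, $\overrightarrow{E}\subseteq V\times V$, be a directed graph (self-loops allowed) in which every vertex $j$ has in-degree $d_j^{\rm in}=|\{i:(i,j)\in\overrightarrow{E}\}|\ge1$. Let $p_v,q_v\in[0,1]$ for $v\in V$. $\mathrm{Rad}(p)$ is the law on $\{-1,1\}$ giving mass $p$ to $1$. Let $\{\sigma^{(v)},\xi_n^{(v)},D_n^{(v)},u_n^{(v)}: n\ge1,v\in V\}$ be independent with $\sigma^{(v)}\sim\mathrm{Rad}(q_v)$, $\xi_n^{(v)}\sim\mathrm{Rad}(p_v)$, $D_n^{(v)}\sim\mathrm{Unif}\{1,\dots,n\}$, $u_n^{(v)}\sim\mathrm{Unif}\{v':(v',v)\in\overrightarrow{E}\}$. Define $X_1^{(v)}=\sigma^{(v)}$ and, for $n\ge1$, $X_{n+1}^{(v)}=\xi_n^{(v)}X^{(u_n^{(v)})}_{D_n^{(v)}}$;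 set $X_n=(X_n^{(1)},\dots,X_n^{(k)})$, $S_0=0$, $S_n=\sum_{j=1}^nX_j$. The process $(S_n)$ is called the ERWG process. Its memory matrix is the $k\times k$ matrix $B$ with $B_{i,j}=\frac{2p_j-1}{d_j^{\rm in}}\mathbf{1}_{\{(i,j)\in\overrightarrow{E}\}}$, and $\eta$ is the maximum of the real parts of the eigenvalues of $B$. All vectors are row vectors; $I$ is the identity. Jordan data. Let $\lambda_1,\dots,\lambda_s$ be the distinct eigenvalues of $B$, so that $1-\lambda_1,\dots,1-\lambda_s$ are the distinct eigenvalues of $\mathbf{H}=I-B$. Fix an invertible $\mathbf{T}\in\mathbb{C}^{k\times k}$ giving the (upper triangular) Jordan canonical form $\mathbf{T}^{-1}\mathbf{H}\mathbf{T}=\mathrm{diag}(\mathbf{J}_1,\dots,\mathbf{J}_s)$, where $\mathbf{J}_t$ is the $\nu_t\times\nu_t$ Jordan part belonging to the eigenvalue $1-\lambda_t$ (so $\nu_t$ is the algebraic multiplicity of $1-\lambda_t$). Set $\nu=\max\{\nu_t:\Re(\lambda_t)=\eta\}$. *)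

theory Defs
  imports "HOL-Probability.Probability" "Jordan_Normal_Form.Spectral_Radius"
begin

hide_type (open) Finite_Cartesian_Product.vec
hide_const (open) Finite_Cartesian_Product.vec Finite_Cartesian_Product.mat
no_notation Finite_Cartesian_Product.vec_nth (infixl \<open>$\<close> 90)

(* Vertices are numbered 0, ..., k - 1, matching the index convention of the matrix library.
   The time index n starts at 1. *)

definition in_nbrs :: "(nat \<times> nat) set \<Rightarrow> nat \<Rightarrow> nat set" where
  "in_nbrs E v = {v'. (v', v) \<in> E}"

definition rad_pmf :: "real \<Rightarrow> int pmf" where
  "rad_pmf p = map_pmf (\<lambda>b. if b then 1 else -1) (bernoulli_pmf p)"

datatype noise_index = Sig nat | Xi nat nat | Mem nat nat | Nbr nat nat

definition noise_indices :: "nat \<Rightarrow> noise_index set" where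
  "noise_indices k =
     {Sig v | v. v < k} \<union>
     {Xi n v | n v. 1 \<le> n \<and> v < k} \<union>
     {Mem n v | n v. 1 \<le> n \<and> v < k} \<union>
     {Nbr n v | n v. 1 \<le> n \<and> v < k}"

(* indep_vars needs one common value type, so the nat-valued variables are embedded into int;
   the embedding is injective and all spaces carry the discrete sigma-algebra. *)
fun noise :: "(nat \<Rightarrow> 'a \<Rightarrow> int) \<Rightarrow> (nat \<Rightarrow> nat \<Rightarrow> 'a \<Rightarrow> int) \<Rightarrow> (nat \<Rightarrow> nat \<Rightarrow> 'a \<Rightarrow> nat)
    \<Rightarrow> (nat \<Rightarrow> nat \<Rightarrow> 'a \<Rightarrow> nat) \<Rightarrow> noise_index \<Rightarrow> 'a \<Rightarrow> int" where
  "noise \<sigma> \<xi> D u (Sig v) = \<sigma> v"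
| "noise \<sigma> \<xi> D u (Xi n v) = \<xi> n v"
| "noise \<sigma> \<xi> D u (Mem n v) = (\<lambda>\<omega>. int (D n v \<omega>))"
| "noise \<sigma> \<xi> D u (Nbr n v) = (\<lambda>\<omega>. int (u n v \<omega>))"

locale erwg = prob_space M for M :: "'a measure" +
  fixes k :: nat and E :: "(nat \<times> nat) set" and p q :: "nat \<Rightarrow> real"
    and \<sigma> :: "nat \<Rightarrow> 'a \<Rightarrow> int" and \<xi> :: "nat \<Rightarrow> nat \<Rightarrow> 'a \<Rightarrow> int"
    and D u :: "nat \<Rightarrow> nat \<Rightarrow> 'a \<Rightarrow> nat"
  assumes k_pos: "1 \<le> k"
    and edges: "E \<subseteq> {..<k} \<times> {..<k}"
    and indegree_pos: "\<And>v. v < k \<Longrightarrow> 1 \<le> card (in_nbrs E v)"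
    and p_range: "\<And>v. v < k \<Longrightarrow> p v \<in> {0..1}"
    and q_range: "\<And>v. v < k \<Longrightarrow> q v \<in> {0..1}"
    and indep: "indep_vars (\<lambda>_. count_space UNIV) (noise \<sigma> \<xi> D u) (noise_indices k)"
    and sigma_law: "\<And>v. v < k \<Longrightarrow>
      distr M (count_space UNIV) (\<sigma> v) = measure_pmf (rad_pmf (q v))"
    and xi_law: "\<And>n v. 1 \<le> n \<Longrightarrow> v < k \<Longrightarrow>
      distr M (count_space UNIV) (\<xi> n v) = measure_pmf (rad_pmf (p v))"
    and D_law: "\<And>n v. 1 \<le> n \<Longrightarrow> v < k \<Longrightarrow>
      distr M (count_space UNIV) (D n v) = measure_pmf (pmf_of_set {1..n})"
    and u_law: "\<And>n v. 1 \<le> n \<Longrightarrow> v < k \<Longrightarrow>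
      distr M (count_space UNIV) (u n v) = measure_pmf (pmf_of_set (in_nbrs E v))"

(* The laws force D n v to lie in {1..n} only almost surely. The value 0 is a dummy for
   time 0 and for the null set where D n v falls outside {1..n}. *)
fun erwg_step :: "(nat \<Rightarrow> 'a \<Rightarrow> int) \<Rightarrow> (nat \<Rightarrow> nat \<Rightarrow> 'a \<Rightarrow> int) \<Rightarrow> (nat \<Rightarrow> nat \<Rightarrow> 'a \<Rightarrow> nat)
    \<Rightarrow> (nat \<Rightarrow> nat \<Rightarrow> 'a \<Rightarrow> nat) \<Rightarrow> nat \<Rightarrow> nat \<Rightarrow> 'a \<Rightarrow> int" where
  "erwg_step \<sigma> \<xi> D u 0 v \<omega> = 0"
| "erwg_step \<sigma> \<xi> D u (Suc 0) v \<omega> = \<sigma> v \<omega>"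
| "erwg_step \<sigma> \<xi> D u (Suc (Suc n)) v \<omega> =
     \<xi> (Suc n) v \<omega> *
     (if D (Suc n) v \<omega> \<in> {1..Suc n}
      then erwg_step \<sigma> \<xi> D u (D (Suc n) v \<omega>) (u (Suc n) v \<omega>) \<omega>
      else 0)"

definition erwg_walk :: "(nat \<Rightarrow> 'a \<Rightarrow> int) \<Rightarrow> (nat \<Rightarrow> nat \<Rightarrow> 'a \<Rightarrow> int) \<Rightarrow> (nat \<Rightarrow> nat \<Rightarrow> 'a \<Rightarrow> nat)
    \<Rightarrow> (nat \<Rightarrow> nat \<Rightarrow> 'a \<Rightarrow> nat) \<Rightarrow> nat \<Rightarrow> nat \<Rightarrow> 'a \<Rightarrow> int" where
  "erwg_walk \<sigma> \<xi> D u n v \<omega> = (\<Sum>j = 1..n. erwg_step \<sigma> \<xi> D u j v \<omega>)"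

definition memory_matrix :: "nat \<Rightarrow> (nat \<times> nat) set \<Rightarrow> (nat \<Rightarrow> real) \<Rightarrow> complex mat" where
  "memory_matrix k E p = mat k k (\<lambda>(i, j).
     if (i, j) \<in> E then complex_of_real ((2 * p j - 1) / real (card (in_nbrs E j))) else 0)"

definition max_Re_eigenvalue :: "complex mat \<Rightarrow> real" where
  "max_Re_eigenvalue A = Max (Re ` spectrum A)"

(* The part of a Jordan form belonging to the eigenvalue a: any number of blocks, all with
   eigenvalue a. *)
definition is_jordan_part :: "'a :: {zero, one} \<Rightarrow> 'a mat \<Rightarrow> bool" where
  "is_jordan_part a J \<longleftrightarrow> (\<exists>ns. 0 \<notin> set ns \<and> J = jordan_matrix (map (\<lambda>m. (m, a)) ns))"

definition row_mult :: "'a :: semiring_0 vec \<Rightarrow> 'a mat \<Rightarrow> 'a vec" where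
  "row_mult v A = vec (dim_col A) (\<lambda>j. v \<bullet> col A j)"

end

theory Submission
  imports Defs "HOL-Real_Asymp.Real_Asymp"
begin

text \<open>
  Conditionally on the past, the step at time \<open>n + 1\<close> has mean \<open>S n B / n\<close>, so
  \<open>S (n + 1) = S n (I + B / n) + (N (n + 1) - N n)\<close> for a martingale \<open>N\<close> with bounded increments.
  An Azuma--Hoeffding estimate and the Borel--Cantelli lemma give \<open>N n = O(n powr \<beta>)\<close> almost surely
  for every \<open>\<beta> > 1/2\<close>; fix such a \<open>\<beta> < \<eta>\<close>. From here on the argument is deterministic:
  \<open>R = S - N\<close> satisfies \<open>R (n + 1) = R n (I + B / n) + N n B / n\<close>, where the perturbation is now
  small without any cancellation. In the coordinates \<open>y = R T\<close> a Jordan block with eigenvalue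
  \<open>\<mu>\<close> of \<open>B\<close> becomes the chain
  \<open>y\<^sub>r (n + 1) = (1 + \<mu> / n) y\<^sub>r n - y\<^sub>r\<^sub>-\<^sub>1 n / n + O(n powr (\<beta> - 1))\<close>. After division by the exact
  solution of \<open>z (n + 1) = (1 + \<mu> / n) z n\<close>, which is asymptotic to a multiple of \<open>n powr \<mu>\<close>,
  the first coordinate converges when \<open>Re \<mu> = \<eta>\<close>, and each further one gains a factor
  \<open>ln n\<close> by the Stolz--Cesaro lemma; coordinates with \<open>Re \<mu> < \<eta>\<close> are \<open>o(n powr \<eta>)\<close>.
  Only the last coordinate of a part consisting of a single block of the maximal size \<open>\<nu>\<close> reaches
  the order \<open>n powr \<eta> * ln n ^ (\<nu> - 1)\<close>; a part of size \<open>\<nu>\<close> split into several blocks has limit 0.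
\<close>

section \<open>Scalar recursions\<close>

text \<open>One-sided Stolz--Cesaro: summing the increment bound from a late \<open>N\<close> on
  gives \<open>e n \<le> e N + \<epsilon> / 2 * (b n - b N)\<close>, and the divergence of
  \<open>b\<close> absorbs \<open>e N\<close>. An upper bound suffices because \<open>e\<close> is
  nonnegative; in the applications it is built from a norm.\<close>

lemma stolz_null:
  fixes e b d :: "nat \<Rightarrow> real"
  assumes step: "eventually (\<lambda>n. e (Suc n) - e n \<le> d n * (b (Suc n) - b n)) sequentially"
    and d: "d \<longlonglongrightarrow> 0"
    and b_mono: "eventually (\<lambda>n. b n \<le> b (Suc n)) sequentially"
    and b_top: "filterlim b at_top sequentially"
    and nonneg: "eventually (\<lambda>n. 0 \<le> e n) sequentially"
  shows "(\<lambda>n. e n / b n) \<longlonglongrightarrow> 0"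
proof (rule LIMSEQ_I)
  fix \<epsilon> :: real assume eps: "0 < \<epsilon>"
  have "eventually (\<lambda>n. d n < \<epsilon> / 2) sequentially"
    using order_tendstoD(2)[OF d, of "\<epsilon> / 2"] eps by simp
  moreover have "eventually (\<lambda>n. b n > 0) sequentially"
    using b_top by (simp add: filterlim_at_top_dense)
  ultimately have "eventually (\<lambda>n. d n < \<epsilon> / 2 \<and> b n > 0 \<and> b n \<le> b (Suc n) \<and>
      e (Suc n) - e n \<le> d n * (b (Suc n) - b n) \<and> 0 \<le> e n) sequentially"
    using step b_mono nonneg by eventually_elim auto
  then obtain N where N: "\<And>n. n \<ge> N \<Longrightarrow> d n < \<epsilon> / 2 \<and> b n > 0 \<and> b n \<le> b (Suc n) \<and>
      e (Suc n) - e n \<le> d n * (b (Suc n) - b n) \<and> 0 \<le> e n"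
    unfolding eventually_sequentially by blast
  have bound: "e n \<le> e N + \<epsilon> / 2 * (b n - b N)" if "n \<ge> N" for n
    using that
  proof (induction n rule: dec_induct)
    case (step n)
    have "d n * (b (Suc n) - b n) \<le> \<epsilon> / 2 * (b (Suc n) - b n)"
      using N[of n] step by (intro mult_right_mono) auto
    moreover have "e (Suc n) - e n \<le> d n * (b (Suc n) - b n)" using N[of n] step by simp
    ultimately have "e (Suc n) \<le> (e N + \<epsilon> / 2 * (b n - b N)) + \<epsilon> / 2 * (b (Suc n) - b n)"
      using step.IH by linarith
    also have "\<dots> = e N + \<epsilon> / 2 * (b (Suc n) - b N)"
      by (simp add: field_simps)
    finally show ?case .
  qed simp
  \<comment> \<open>Beyond this threshold the starting value costs less than the other
    \<open>\<epsilon> / 2\<close>.\<close>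
  have "eventually (\<lambda>n. b n > 2 * e N / \<epsilon>) sequentially"
    using b_top by (simp add: filterlim_at_top_dense)
  then obtain N' where N': "\<And>n. n \<ge> N' \<Longrightarrow> b n > 2 * e N / \<epsilon>"
    unfolding eventually_sequentially by blast
  show "\<exists>no. \<forall>n\<ge>no. norm (e n / b n - 0) < \<epsilon>"
  proof (intro exI allI impI)
    fix n assume n: "n \<ge> max N N'"
    have "e n \<le> e N + \<epsilon> / 2 * b n - \<epsilon> / 2 * b N"
      using bound[of n] n by (simp add: field_simps)
    also have "\<dots> < e N + \<epsilon> / 2 * b n" using N[of N] eps by simp
    also have "e N < \<epsilon> / 2 * b n" using N'[of n] n eps by (simp add: field_simps)
    finally have "e n < \<epsilon> * b n" by simp
    then show "norm (e n / b n - 0) < \<epsilon>" using N[of n] n by (simp add: field_simps)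
  qed
qed

section \<open>Rising factors and their growth\<close>

text \<open>This is \<open>\<Gamma>(n + z) / (\<Gamma>(n) \<Gamma>(z))\<close>, an exact solution of the unperturbed
  recursion \<open>y (n + 1) = (1 + z / n) y n\<close>.\<close>
definition rising_factor :: "complex \<Rightarrow> nat \<Rightarrow> complex" where
  "rising_factor z n = pochhammer z n / fact (n - 1)"

lemma rising_factor_Suc:
  "1 \<le> n \<Longrightarrow> rising_factor z (Suc n) = (1 + z / of_nat n) * rising_factor z n"
proof (cases n)
  case (Suc m)
  have "pochhammer z (Suc n) / fact n =
      (z + of_nat n) / of_nat n * (pochhammer z n / fact (n - 1))"
    using Suc pochhammer_Suc[of z n] by (simp del: of_nat_Suc)
  also have "(z + of_nat n) / of_nat n = 1 + z / of_nat n"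
    using Suc by (simp add: field_simps del: of_nat_Suc)
  finally show ?thesis by (simp add: rising_factor_def)
qed simp

lemma add_of_nat_nonzero: "0 < Re z \<Longrightarrow> z + of_nat n \<noteq> 0"
  by (auto simp: complex_eq_iff)

lemma rising_factor_nonzero: "0 < Re z \<Longrightarrow> rising_factor z n \<noteq> 0"
  unfolding rising_factor_def by (auto simp: pochhammer_eq_0_iff)

lemma rGamma_nonzero: "0 < Re z \<Longrightarrow> rGamma z \<noteq> 0"
  using rGamma_eq_zero_iff[of z] by (auto elim!: nonpos_Ints_cases)

lemma tendsto_of_nat_divide_add:
  "(\<lambda>n. of_nat n / (of_nat n + z :: complex)) \<longlonglongrightarrow> 1"
proof -
  have "(\<lambda>n. 1 + z / of_nat n) \<longlonglongrightarrow> 1 + 0"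
    by (intro tendsto_add tendsto_const lim_const_over_n)
  then have "(\<lambda>n. inverse (1 + z / of_nat n)) \<longlonglongrightarrow> inverse (1 + 0)"
    by (rule tendsto_inverse) simp
  moreover have "eventually (\<lambda>n. inverse (1 + z / of_nat n) = of_nat n / (of_nat n + z)) sequentially"
    using eventually_gt_at_top[of 0]
  proof eventually_elim
    case (elim n)
    have "1 + z / of_nat n = (of_nat n + z) / of_nat n" using elim by (simp add: field_simps)
    then show ?case by simp
  qed
  ultimately show ?thesis by (simp add: tendsto_cong)
qed

text \<open>Gauss's product for 1/Gamma: \<open>rGamma_series z n\<close> differs from this quotient
  only by the factor \<open>(n + z) / n\<close>, which tends to 1.\<close>

lemma rising_factor_asymp:
  assumes "0 < Re z"
  shows "(\<lambda>n. rising_factor z n / exp (z * of_real (ln (real n)))) \<longlonglongrightarrow> rGamma z"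
proof -
  have "(\<lambda>n. rGamma_series z n * (of_nat n / (of_nat n + z))) \<longlonglongrightarrow> rGamma z * 1"
    by (intro tendsto_mult tendsto_of_nat_divide_add rGamma_series_LIMSEQ)
  moreover have "eventually (\<lambda>n. rGamma_series z n * (of_nat n / (of_nat n + z)) =
      rising_factor z n / exp (z * of_real (ln (real n)))) sequentially"
    using eventually_gt_at_top[of 0]
  proof eventually_elim
    case (elim n)
    then obtain m where m: "n = Suc m" by (cases n) auto
    have "z + of_nat n \<noteq> 0" "complex_of_nat n \<noteq> 0"
      using add_of_nat_nonzero[OF assms] elim by auto
    moreover have "rGamma_series z n = pochhammer z n * (z + of_nat n) /
        (fact (n - 1) * of_nat n * exp (z * of_real (ln (real n))))"
      unfolding rGamma_series_def m by (simp add: pochhammer_Suc field_simps)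
    ultimately show ?case
      by (simp add: rising_factor_def add.commute)
  qed
  ultimately show ?thesis by (simp add: tendsto_cong)
qed

lemma norm_rising_factor_asymp:
  assumes "0 < Re z"
  shows "(\<lambda>n. norm (rising_factor z n) / real n powr Re z) \<longlonglongrightarrow> norm (rGamma z)"
proof -
  have "(\<lambda>n. norm (rising_factor z n / exp (z * of_real (ln (real n))))) \<longlonglongrightarrow> norm (rGamma z)"
    by (intro tendsto_norm rising_factor_asymp assms)
  then show ?thesis
    by (rule Lim_transform_eventually[OF _ eventually_mono[OF eventually_gt_at_top[of 0]]])
      (simp add: norm_divide powr_def)
qed

lemma norm_rising_factor_lower:
  assumes "0 < Re z"
  obtains c where "0 < c"
    "eventually (\<lambda>n. c * real n powr Re z \<le> norm (rising_factor z n)) sequentially"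
proof
  \<comment> \<open>Half of the limiting ratio; positive because 1/Gamma vanishes only at the
    nonpositive integers.\<close>
  let ?c = "norm (rGamma z) / 2"
  show "0 < ?c" using rGamma_nonzero[OF assms] by simp
  then have "eventually (\<lambda>n. ?c < norm (rising_factor z n) / real n powr Re z) sequentially"
    using order_tendstoD(1)[OF norm_rising_factor_asymp[OF assms], of ?c] by simp
  then show "eventually (\<lambda>n. ?c * real n powr Re z \<le> norm (rising_factor z n)) sequentially"
    using eventually_gt_at_top[of 0] by eventually_elim (simp add: field_simps)
qed

text \<open>The discrete derivative of the comparison sequence in the critical case. Factoring the
  difference of powers leaves \<open>n (ln (n + 1) - ln n)\<close>, which tends to 1, times
  \<open>Suc a\<close> terms that each tend to 1 after division by \<open>ln n ^ a\<close>.\<close>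

lemma ln_power_increment:
  "(\<lambda>n. (ln (real (Suc n)) ^ Suc a - ln (real n) ^ Suc a) / (ln (real n) ^ a / real n))
     \<longlonglongrightarrow> real (Suc a)"
proof -
  let ?q = "\<lambda>n. ln (real (Suc n)) / ln (real n)"
  have q: "?q \<longlonglongrightarrow> 1" by real_asymp
  have d: "(\<lambda>n. real n * (ln (real (Suc n)) - ln (real n))) \<longlonglongrightarrow> 1" by real_asymp
  have "(\<lambda>n. real n * (ln (real (Suc n)) - ln (real n)) * (\<Sum>p<Suc a. ?q n ^ p)) \<longlonglongrightarrow>
      1 * (\<Sum>p<Suc a. 1 ^ p)"
    by (intro tendsto_mult d tendsto_sum tendsto_power q)
  moreover have "eventually (\<lambda>n. real n * (ln (real (Suc n)) - ln (real n)) * (\<Sum>p<Suc a. ?q n ^ p) =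
      (ln (real (Suc n)) ^ Suc a - ln (real n) ^ Suc a) / (ln (real n) ^ a / real n)) sequentially"
    using eventually_gt_at_top[of 1]
  proof eventually_elim
    case (elim n)
    then have l: "ln (real n) > 0" by simp
    have "(\<Sum>p<Suc a. ln (real (Suc n)) ^ p * ln (real n) ^ (a - p)) =
        ln (real n) ^ a * (\<Sum>p<Suc a. ?q n ^ p)"
      unfolding sum_distrib_left
    proof (rule sum.cong[OF refl])
      fix p assume "p \<in> {..<Suc a}"
      then have "ln (real n) ^ a = ln (real n) ^ p * ln (real n) ^ (a - p)"
        by (simp flip: power_add)
      with l show "ln (real (Suc n)) ^ p * ln (real n) ^ (a - p) = ln (real n) ^ a * ?q n ^ p"
        by (simp add: power_divide)
    qed
    with l elim show ?case
      by (subst power_diff_sumr2) (simp add: field_simps)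
  qed
  ultimately show ?thesis by (simp add: tendsto_cong)
qed

section \<open>Perturbed scalar recursions\<close>

locale perturbed_recursion =
  fixes z :: complex and y g :: "nat \<Rightarrow> complex"
  assumes rec: "\<And>n. 1 \<le> n \<Longrightarrow> y (Suc n) = (1 + z / of_nat n) * y n + g n / of_nat n"
begin

text \<open>Variation of constants: dividing by the homogeneous solution leaves only the forcing.
  The \<open>n\<close> under the forcing term combines with the factor \<open>1 + z / n\<close> into
  \<open>n + z\<close>.\<close>

lemma quotient_increment:
  assumes "0 < Re z" "1 \<le> n"
  shows "y (Suc n) / rising_factor z (Suc n) - y n / rising_factor z n =
    g n / rising_factor z n / (of_nat n + z)"
proof -
  have "of_nat n + z \<noteq> 0" "complex_of_nat n \<noteq> 0"
    using add_of_nat_nonzero[OF assms(1), of n] assms(2) by (auto simp: add.commute)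
  moreover have "rising_factor z n \<noteq> 0" using rising_factor_nonzero assms(1) .
  moreover have "1 + z / of_nat n = (of_nat n + z) / of_nat n"
    using assms(2) by (simp add: field_simps)
  ultimately show ?thesis
    unfolding rec[OF assms(2)] rising_factor_Suc[OF assms(2)]
    by (simp add: divide_simps)
qed

text \<open>The increments of the quotient are \<open>O(n powr (\<beta> - Re z - 1))\<close>, hence
  absolutely summable, and their partial sums telescope.\<close>

lemma critical_base:
  assumes z: "0 < Re z" and g: "eventually (\<lambda>n. norm (g n) \<le> C * real n powr \<beta>) sequentially"
    and \<beta>: "\<beta> < Re z"
  shows "convergent (\<lambda>n. y n / rising_factor z n)"
proof -
  let ?w = "\<lambda>n. y n / rising_factor z n"
  obtain c where c: "0 < c"
    "eventually (\<lambda>n. c * real n powr Re z \<le> norm (rising_factor z n)) sequentially"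
    using norm_rising_factor_lower[OF z] .
  have "summable (\<lambda>n. ?w (Suc n) - ?w n)"
  proof (rule summable_comparison_test_ev)
    show "summable (\<lambda>n. C / c * real n powr (\<beta> - Re z - 1))"
      using \<beta> by (intro summable_mult) (simp add: summable_real_powr_iff)
    show "eventually (\<lambda>n. norm (?w (Suc n) - ?w n) \<le> C / c * real n powr (\<beta> - Re z - 1)) sequentially"
      using g c(2) eventually_ge_at_top[of 1]
    proof eventually_elim
      case (elim n)
      \<comment> \<open>As \<open>Re z > 0\<close>, the shifted denominator is at least
        \<open>n\<close>.\<close>
      have "Re (of_nat n + z) \<le> norm (of_nat n + z)" by (rule complex_Re_le_cmod)
      then have n: "real n \<le> norm (of_nat n + z)" using z by simp
      have "norm (?w (Suc n) - ?w n) = norm (g n) / (norm (rising_factor z n) * norm (of_nat n + z))"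
        using quotient_increment[OF z elim(3)] by (simp add: norm_divide norm_mult)
      also have "\<dots> \<le> (C * real n powr \<beta>) / ((c * real n powr Re z) * real n)"
        using elim n c(1) order_trans[OF norm_ge_zero elim(1)]
        by (intro frac_le mult_mono elim) (auto intro!: mult_pos_pos)
      also have "\<dots> = C / c * real n powr (\<beta> - Re z - 1)"
        using elim(3) by (simp add: powr_diff)
      finally show ?case .
    qed
  qed
  then have "convergent (\<lambda>m. (\<Sum>n<m. ?w (Suc n) - ?w n) + ?w 0)"
    by (intro convergent_add convergent_const) (simp add: summable_iff_convergent)
  then show ?thesis by (simp add: sum_lessThan_telescope[of ?w])
qed

text \<open>Stolz--Cesaro against \<open>ln n ^ Suc a\<close>: the quotient has increments like
  \<open>c * ln n ^ a / n\<close>, the comparison sequence like \<open>Suc a * ln n ^ a / n\<close>.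
  Since \<open>stolz_null\<close> concerns real sequences, it is applied to the norm of the error
  against the expected limit.\<close>

lemma critical_step:
  assumes z: "0 < Re z"
    and g: "(\<lambda>n. g n / (rising_factor z n * of_real (ln (real n) ^ a))) \<longlonglongrightarrow> c"
  shows "(\<lambda>n. y n / (rising_factor z n * of_real (ln (real n) ^ Suc a))) \<longlonglongrightarrow> c / of_nat (Suc a)"
proof -
  let ?w = "\<lambda>n. y n / rising_factor z n"
  let ?b = "\<lambda>n. ln (real n) ^ Suc a"
  let ?db = "\<lambda>n. ?b (Suc n) - ?b n"
  let ?L = "c / of_nat (Suc a)"
  let ?e = "\<lambda>n. norm (?w n - ?L * of_real (?b n))"
  \<comment> \<open>The ratio of the two increments minus its limit, split into factors with known
    limits: the normalised forcing, the shift from \<open>n\<close> to \<open>n + z\<close>, and the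
    reciprocal of the normalised logarithmic increment.\<close>
  let ?d = "\<lambda>n. norm ((g n / (rising_factor z n * of_real (ln (real n) ^ a))) *
     (of_nat n / (of_nat n + z)) * inverse (of_real (?db n / (ln (real n) ^ a / real n))) - ?L)"
  have "(\<lambda>n. inverse (of_real (?db n / (ln (real n) ^ a / real n)))) \<longlonglongrightarrow>
      inverse (of_real (real (Suc a)) :: complex)"
    by (intro tendsto_inverse tendsto_of_real ln_power_increment)
      (simp only: of_real_eq_0_iff of_nat_eq_0_iff nat.distinct not_False_eq_True)
  from tendsto_mult[OF tendsto_mult[OF g tendsto_of_nat_divide_add] this]
  have "(\<lambda>n. g n / (rising_factor z n * of_real (ln (real n) ^ a)) *
     (of_nat n / (of_nat n + z)) * inverse (of_real (?db n / (ln (real n) ^ a / real n)))) \<longlonglongrightarrow> ?L"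
    by (simp add: divide_inverse del: of_nat_Suc)
  from tendsto_norm_zero[OF LIM_zero[OF this]] have d: "?d \<longlonglongrightarrow> 0" .
  have b_top: "filterlim ?b at_top sequentially"
    by (intro filterlim_pow_at_top) (simp, real_asymp)
  have db: "eventually (\<lambda>n. 0 < ?db n) sequentially"
    using eventually_gt_at_top[of 1]
  proof eventually_elim
    case (elim n)
    then have "ln (real n) < ln (real (Suc n))" "0 \<le> ln (real n)" by auto
    then show ?case using power_strict_mono[of "ln (real n)" "ln (real (Suc n))" "Suc a"] by simp
  qed
  have step: "eventually (\<lambda>n. ?e (Suc n) - ?e n \<le> ?d n * ?db n) sequentially"
    using db eventually_gt_at_top[of 1]
  proof eventually_elim
    case (elim n)
    have l: "ln (real n) \<noteq> 0" "n \<noteq> 0" using elim by auto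
    have "?e (Suc n) - ?e n \<le> norm ((?w (Suc n) - ?L * of_real (?b (Suc n))) - (?w n - ?L * of_real (?b n)))"
      by (rule norm_triangle_ineq2)
    also have "(?w (Suc n) - ?L * of_real (?b (Suc n))) - (?w n - ?L * of_real (?b n)) =
        (?w (Suc n) - ?w n) - ?L * of_real (?db n)"
      by (simp add: algebra_simps del: power_Suc of_nat_Suc)
    also have "?w (Suc n) - ?w n = g n / rising_factor z n / (of_nat n + z)"
      using quotient_increment[OF z] elim by simp
    also have "\<dots> = (g n / (rising_factor z n * of_real (ln (real n) ^ a))) *
     (of_nat n / (of_nat n + z)) * inverse (of_real (?db n / (ln (real n) ^ a / real n))) * of_real (?db n)"
    proof -
      have "x / w / s = x / (w * of_real m) * (of_nat n / s) * inverse (of_real (r / (m / real n))) * of_real r"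
        if "m \<noteq> 0" "r \<noteq> 0" for x w s :: complex and m r :: real
        using that l(2) by (simp add: divide_simps)
      then show ?thesis using l(1) elim(1) by (metis less_irrefl power_not_zero)
    qed
    finally have "?e (Suc n) - ?e n \<le> norm (((g n / (rising_factor z n * of_real (ln (real n) ^ a))) *
     (of_nat n / (of_nat n + z)) * inverse (of_real (?db n / (ln (real n) ^ a / real n))) - ?L) * of_real (?db n))"
      by (simp only: left_diff_distrib)
    also have "\<dots> = ?d n * ?db n"
      unfolding norm_mult norm_of_real using elim(1) by (simp only: abs_of_pos)
    finally show ?case .
  qed
  have "(\<lambda>n. ?e n / ?b n) \<longlonglongrightarrow> 0"
    by (rule stolz_null[OF step d _ b_top]) (use db in \<open>auto elim: eventually_mono\<close>)
  then have "(\<lambda>n. norm (y n / (rising_factor z n * of_real (?b n)) - ?L)) \<longlonglongrightarrow> 0"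
  proof (rule Lim_transform_eventually)
    show "eventually (\<lambda>n. ?e n / ?b n = norm (y n / (rising_factor z n * of_real (?b n)) - ?L)) sequentially"
      using eventually_gt_at_top[of 1]
    proof eventually_elim
      case (elim n)
      then have b: "?b n > 0" by simp
      have "y n / (rising_factor z n * of_real (?b n)) - ?L = (?w n - ?L * of_real (?b n)) / of_real (?b n)"
        using b elim by (simp add: diff_divide_distrib)
      with b show ?case by (simp only: norm_divide norm_of_real abs_of_pos)
    qed
  qed
  then show ?thesis using LIM_zero_cancel tendsto_norm_zero_iff by blast
qed

text \<open>The norms are compared with the recursion for a real exponent \<open>\<eta> - c\<close>, and the Stolz--Cesaro
  lemma is applied against the ratio of the rising factors of \<open>\<eta>\<close> and \<open>\<eta> - c\<close>, which grows
  like \<open>n powr c\<close>.\<close>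
lemma subcritical:
  assumes \<eta>: "0 < \<eta>" "Re z < \<eta>" and g: "(\<lambda>n. g n / of_real (real n powr \<eta>)) \<longlonglongrightarrow> 0"
  shows "(\<lambda>n. y n / of_real (real n powr \<eta>)) \<longlonglongrightarrow> 0"
proof -
  \<comment> \<open>The first bound keeps the exponent \<open>\<eta> - c\<close> positive, so that
    its rising factor does not vanish; the second leaves a gap between \<open>Re z\<close> and
    \<open>\<eta> - c\<close>.\<close>
  define c where "c = min (\<eta> / 2) ((\<eta> - Re z) / 2)"
  have c: "0 < c" "c < \<eta>" "Re z + c < \<eta>" using \<eta> by (auto simp: c_def min_def field_simps)
  define P where "P = (\<lambda>n. norm (rising_factor (of_real \<eta>) n))"
  define Q where "Q = (\<lambda>n. norm (rising_factor (of_real (\<eta> - c)) n))"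
  have P_lim: "(\<lambda>n. P n / real n powr \<eta>) \<longlonglongrightarrow> norm (rGamma (complex_of_real \<eta>))"
    using norm_rising_factor_asymp[of "of_real \<eta>"] \<eta> by (simp add: P_def)
  have Q_lim: "(\<lambda>n. Q n / real n powr (\<eta> - c)) \<longlonglongrightarrow> norm (rGamma (complex_of_real (\<eta> - c)))"
    using norm_rising_factor_asymp[of "of_real (\<eta> - c)"] c by (simp add: Q_def)
  have pos: "P n > 0" "Q n > 0" for n
    using rising_factor_nonzero[of "of_real \<eta>"] rising_factor_nonzero[of "of_real (\<eta> - c)"] c \<eta>
    by (auto simp: P_def Q_def)
  have Gpos: "norm (rGamma (complex_of_real \<eta>)) > 0" "norm (rGamma (complex_of_real (\<eta> - c))) > 0"
    using rGamma_nonzero c \<eta> by auto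
  have norm_factor: "norm (1 + of_real x / of_nat n :: complex) = (real n + x) / real n"
    if "0 < x" "1 \<le> n" for x n
  proof -
    have "1 + of_real x / of_nat n = (of_real ((real n + x) / real n) :: complex)"
      using that by (simp add: field_simps)
    then show ?thesis using that by (simp del: of_real_divide of_real_add)
  qed
  have P_Suc: "P (Suc n) = (real n + \<eta>) / real n * P n" if "1 \<le> n" for n
    using that \<eta> by (simp only: P_def rising_factor_Suc norm_mult norm_factor)
  have Q_Suc: "Q (Suc n) = (real n + (\<eta> - c)) / real n * Q n" if "1 \<le> n" for n
    using that c by (simp only: Q_def rising_factor_Suc norm_mult norm_factor)
  define b where "b = (\<lambda>n. P n / Q n)"
  define e where "e = (\<lambda>n. norm (y n) / Q n)"
  define d where "d = (\<lambda>n. norm (g n) / P n / c)"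
  \<comment> \<open>The relative growth of \<open>b\<close> carries a factor \<open>c\<close>, which
    is why \<open>d\<close> is divided by \<open>c\<close>.\<close>
  have b_Suc: "b (Suc n) - b n = b n * c / (real n + \<eta> - c)" if "1 \<le> n" for n
  proof -
    have n: "real n > 0" "real n + \<eta> - c > 0" using that c \<eta> by auto
    have "b (Suc n) = (real n + \<eta>) / (real n + \<eta> - c) * b n"
      using n pos[of n] unfolding b_def P_Suc[OF that] Q_Suc[OF that] by (simp add: add_diff_eq)
    then show ?thesis using n by (simp add: field_simps)
  qed
  have "(\<lambda>n. (P n / real n powr \<eta>) / (Q n / real n powr (\<eta> - c))) \<longlonglongrightarrow>
      norm (rGamma (complex_of_real \<eta>)) / norm (rGamma (complex_of_real (\<eta> - c)))"
    by (intro tendsto_divide P_lim Q_lim) (use Gpos in auto)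
  moreover have "eventually (\<lambda>n. (P n / real n powr \<eta>) / (Q n / real n powr (\<eta> - c)) = b n / real n powr c) sequentially"
    using eventually_gt_at_top[of 0] by eventually_elim (simp add: b_def powr_diff)
  ultimately have b_lim: "(\<lambda>n. b n / real n powr c) \<longlonglongrightarrow>
      norm (rGamma (complex_of_real \<eta>)) / norm (rGamma (complex_of_real (\<eta> - c)))"
    by (simp add: tendsto_cong)
  have n_top: "filterlim (\<lambda>n. real n powr c) at_top sequentially"
    using c by real_asymp
  have "filterlim (\<lambda>n. b n / real n powr c * real n powr c) at_top sequentially"
    by (rule filterlim_tendsto_pos_mult_at_top[OF b_lim _ n_top]) (use Gpos in auto)
  then have b_top: "filterlim b at_top sequentially"
    by (rule filterlim_cong[THEN iffD1, OF refl refl, rotated])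
      (use eventually_gt_at_top[of 0] in \<open>eventually_elim, auto\<close>)
  have P_inv: "(\<lambda>n. real n powr \<eta> / P n) \<longlonglongrightarrow> inverse (norm (rGamma (complex_of_real \<eta>)))"
    using tendsto_inverse[OF P_lim] Gpos by (simp add: field_simps)
  have "(\<lambda>n. norm (g n / of_real (real n powr \<eta>)) * (real n powr \<eta> / P n) / c) \<longlonglongrightarrow>
      0 * inverse (norm (rGamma (complex_of_real \<eta>))) / c"
    by (intro tendsto_divide tendsto_mult P_inv tendsto_const tendsto_norm_zero g) (use c in auto)
  moreover have "eventually (\<lambda>n. norm (g n / of_real (real n powr \<eta>)) * (real n powr \<eta> / P n) / c = d n) sequentially"
    using eventually_gt_at_top[of 0] by eventually_elim (simp add: d_def norm_divide)
  ultimately have d: "d \<longlonglongrightarrow> 0" by (simp add: tendsto_cong)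
  \<comment> \<open>In the squared modulus the term linear in \<open>n\<close> has coefficient
    \<open>2 * Re z\<close>, strictly below \<open>2 * (\<eta> - c)\<close>; for large
    \<open>n\<close> this gap beats the constant \<open>(Re z)^2 + (Im z)^2\<close>.\<close>
  have factor: "eventually (\<lambda>n. norm (of_nat n + z) \<le> real n + \<eta> - c) sequentially"
  proof -
    have "filterlim (\<lambda>n. 2 * (\<eta> - c - Re z) * real n) at_top sequentially"
      using c by real_asymp
    then have "eventually (\<lambda>n. (Re z)\<^sup>2 + (Im z)\<^sup>2 < 2 * (\<eta> - c - Re z) * real n) sequentially"
      by (simp add: filterlim_at_top_dense)
    then show ?thesis
    proof eventually_elim
      case (elim n)
      have "(norm (of_nat n + z))\<^sup>2 = (real n)\<^sup>2 + 2 * real n * Re z + ((Re z)\<^sup>2 + (Im z)\<^sup>2)"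
        by (simp add: cmod_power2 power2_sum)
      also have "\<dots> \<le> (real n)\<^sup>2 + 2 * real n * (\<eta> - c)"
        using elim by (simp add: algebra_simps)
      also have "\<dots> \<le> (real n + (\<eta> - c))\<^sup>2"
        by (simp add: power2_sum)
      finally show ?case
        using c by (auto intro: power2_le_imp_le simp: add_diff_eq)
    qed
  qed
  \<comment> \<open>Division by \<open>Q (Suc n)\<close> reduces the bound on the homogeneous part
    to exactly \<open>e n\<close>, so only the forcing contributes to the increment.\<close>
  have step: "eventually (\<lambda>n. e (Suc n) - e n \<le> d n * (b (Suc n) - b n)) sequentially"
    using factor eventually_ge_at_top[of 1]
  proof eventually_elim
    case (elim n)
    have n: "real n > 0" "real n + \<eta> - c > 0" using elim c \<eta> by auto
    have "y (Suc n) = ((of_nat n + z) * y n + g n) / of_nat n"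
      using rec[OF elim(2)] n by (simp add: field_simps)
    then have "norm (y (Suc n)) = norm ((of_nat n + z) * y n + g n) / real n"
      by (simp add: norm_divide)
    also have "\<dots> \<le> ((real n + \<eta> - c) * norm (y n) + norm (g n)) / real n"
    proof (intro divide_right_mono)
      show "norm ((of_nat n + z) * y n + g n) \<le> (real n + \<eta> - c) * norm (y n) + norm (g n)"
        using norm_triangle_ineq[of "(of_nat n + z) * y n" "g n"]
          mult_right_mono[OF elim(1), of "norm (y n)"] by (simp add: norm_mult)
    qed simp
    finally have "e (Suc n) \<le> ((real n + \<eta> - c) * norm (y n) + norm (g n)) / real n / Q (Suc n)"
      unfolding e_def using pos[of "Suc n"] by (intro divide_right_mono) auto
    also have "\<dots> = e n + norm (g n) / (Q n * (real n + \<eta> - c))"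
      unfolding Q_Suc[OF elim(2)] e_def using n pos[of n]
      by (simp add: divide_simps) (simp add: algebra_simps)
    also have "norm (g n) / (Q n * (real n + \<eta> - c)) = d n * (b (Suc n) - b n)"
      unfolding b_Suc[OF elim(2)] unfolding b_def d_def using c(1) pos[of n] n by (simp add: field_simps)
    finally show ?case by simp
  qed
  have "(\<lambda>n. e n / b n) \<longlonglongrightarrow> 0"
  proof (rule stolz_null[OF step d _ b_top])
    show "eventually (\<lambda>n. b n \<le> b (Suc n)) sequentially"
      using eventually_ge_at_top[of 1]
    proof eventually_elim
      case (elim n)
      have "0 \<le> b n * c / (real n + \<eta> - c)" using pos[of n] c elim by (auto simp: b_def)
      with b_Suc[OF elim] show ?case by simp
    qed
    show "eventually (\<lambda>n. 0 \<le> e n) sequentially"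
      using pos by (auto simp: e_def less_imp_le)
  qed
  \<comment> \<open>\<open>e / b\<close> is \<open>norm y / P\<close>; the limit of
    \<open>P n / n powr \<eta>\<close> restores the required normalisation.\<close>
  then have "(\<lambda>n. e n / b n * (P n / real n powr \<eta>)) \<longlonglongrightarrow> 0 * norm (rGamma (complex_of_real \<eta>))"
    by (intro tendsto_mult P_lim)
  moreover have "e n / b n * (P n / real n powr \<eta>) = norm (y n / of_real (real n powr \<eta>))" for n
    using pos[of n] by (simp add: e_def b_def norm_divide)
  ultimately show ?thesis by (simp add: tendsto_norm_zero_iff)
qed

end

section \<open>Linear recursions in Jordan coordinates\<close>

text \<open>\<open>r\<close> is the position of column \<open>l\<close> inside its own block, and
  \<open>l - r, ..., l\<close> are the columns of that block up to it; the guard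
  \<open>0 < r'\<close> reflects that the first column of a block has nothing above the diagonal.
  The induction peels off the first block: either \<open>l\<close> falls into it, or rows and
  columns shift by \<open>m\<close>.\<close>

lemma jordan_part_column:
  assumes "l < sum_list ns"
  shows "\<exists>r\<le>l. \<forall>r'\<le>r. \<forall>i<sum_list ns. jordan_matrix (map (\<lambda>m. (m, a)) ns) $$ (i, l - r + r') =
    (if i = l - r + r' then a else if 0 < r' \<and> Suc i = l - r + r' then 1 else 0)"
  using assms
proof (induction ns arbitrary: l)
  case (Cons m ns)
  let ?A = "jordan_block m a" and ?B = "jordan_matrix (map (\<lambda>m. (m, a)) ns)"
  have dim_B: "dim_row ?B = sum_list ns" "dim_col ?B = sum_list ns"
    by (simp_all add: comp_def)
  have split: "jordan_matrix (map (\<lambda>m. (m, a)) (m # ns)) =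
      four_block_mat ?A (0\<^sub>m m (sum_list ns)) (0\<^sub>m (sum_list ns) m) ?B"
    by (simp add: jordan_matrix_def Let_def dim_diag_block_mat comp_def case_prod_beta)
  have entry: "jordan_matrix (map (\<lambda>m. (m, a)) (m # ns)) $$ (i, j) =
      (if i < m then if j < m then ?A $$ (i, j) else 0
       else if j < m then 0 else ?B $$ (i - m, j - m))"
    if "i < m + sum_list ns" "j < m + sum_list ns" for i j
    unfolding split using that by (subst index_mat_four_block) (auto simp: dim_B[unfolded jordan_matrix_dim] comp_def)
  show ?case
  proof (cases "l < m")
    case True
    then show ?thesis
      by (intro exI[of _ l]) (auto simp: entry[unfolded list.map])
  next
    case False
    then have "l - m < sum_list ns" using Cons.prems by simp
    from Cons.IH[OF this] obtain r where r: "r \<le> l - m" and col: "\<And>r' i. r' \<le> r \<Longrightarrow> i < sum_list ns \<Longrightarrow>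
        ?B $$ (i, l - m - r + r') =
        (if i = l - m - r + r' then a else if 0 < r' \<and> Suc i = l - m - r + r' then 1 else 0)"
      by blast
    have "jordan_matrix (map (\<lambda>m. (m, a)) (m # ns)) $$ (i, l - r + r') =
        (if i = l - r + r' then a else if 0 < r' \<and> Suc i = l - r + r' then 1 else 0)"
      if "r' \<le> r" "i < sum_list (m # ns)" for r' i
    proof -
      have "l - r + r' - m = l - m - r + r'" "m \<le> l - r + r'" "l - r + r' < m + sum_list ns"
        using r False that Cons.prems by auto
      then have "jordan_matrix (map (\<lambda>m. (m, a)) (m # ns)) $$ (i, l - r + r') =
          (if i < m then 0 else ?B $$ (i - m, l - m - r + r'))"
        using that by (subst entry) auto
      also have "\<dots> = (if i = l - r + r' then a else if 0 < r' \<and> Suc i = l - r + r' then 1 else 0)"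
      proof (cases "i < m")
        case True
        then show ?thesis using \<open>m \<le> l - r + r'\<close> r False by auto
      next
        case False
        then have "i - m < sum_list ns" "i = l - r + r' \<longleftrightarrow> i - m = l - m - r + r'"
          "Suc i = l - r + r' \<longleftrightarrow> Suc (i - m) = l - m - r + r'"
          using that r \<open>\<not> l < m\<close> by auto
        with False that(1) show ?thesis by (simp only: col if_False)
      qed
      finally show ?thesis .
    qed
    moreover have "r \<le> l" using r by simp
    ultimately show ?thesis by blast
  qed
qed simp

text \<open>For square blocks a single offset \<open>o'\<close> locates both the rows and the
  columns of a block.\<close>

lemma diag_block_mat_column:
  assumes "\<And>A. A \<in> set As \<Longrightarrow> dim_col A = dim_row A"
    and "t < length As" "c < dim_row (As ! t)" "i < dim_row (diag_block_mat As)"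
  defines "o' \<equiv> sum_list (map dim_row (take t As))"
  shows "diag_block_mat As $$ (i, o' + c) =
    (if o' \<le> i \<and> i < o' + dim_row (As ! t) then (As ! t) $$ (i - o', c) else 0)"
  using assms(1-4) unfolding o'_def
proof (induction As arbitrary: t i)
  case (Cons A As)
  let ?D = "diag_block_mat As"
  have sq: "dim_col ?D = dim_row ?D" "dim_col A = dim_row A"
    using Cons.prems(1) by (auto simp: dim_diag_block_mat intro!: arg_cong[of _ _ sum_list])
  have entry: "diag_block_mat (A # As) $$ (i, j) =
      (if i < dim_row A then if j < dim_row A then A $$ (i, j) else 0
       else if j < dim_row A then 0 else ?D $$ (i - dim_row A, j - dim_row A))"
    if "i < dim_row A + dim_row ?D" "j < dim_row A + dim_row ?D" for i j
    unfolding diag_block_mat.simps Let_def using that sq by (subst index_mat_four_block) auto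
  have i: "i < dim_row A + dim_row ?D"
    using Cons.prems(4) by (simp add: Let_def)
  show ?case
  proof (cases t)
    case 0
    then show ?thesis using Cons.prems i by (subst entry) auto
  next
    case (Suc t')
    let ?o = "sum_list (map dim_row (take t' As))"
    have "?o + dim_row (As ! t') = sum_list (map dim_row (take (Suc t') As))"
      using Cons.prems Suc by (simp add: take_Suc_conv_app_nth)
    also have "\<dots> \<le> sum_list (map dim_row As)"
      by (subst (2) append_take_drop_id[of "Suc t'" As, symmetric]) (simp only: map_append sum_list_append le_add1)
    finally have "?o + dim_row (As ! t') \<le> dim_row ?D" by (simp add: dim_diag_block_mat)
    then show ?thesis
      using Cons.prems Suc i Cons.IH[of t' "i - dim_row A"] by (subst entry) auto
  qed
qed simp

lemma sum_blocks:
  fixes s :: nat and d :: "nat \<Rightarrow> nat" and f :: "nat \<Rightarrow> 'b :: comm_monoid_add"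
  shows "(\<Sum>j<(\<Sum>t<s. d t). f j) = (\<Sum>t<s. \<Sum>l<d t. f ((\<Sum>t'<t. d t') + l))"
proof (induction s)
  case (Suc s)
  have "(\<Sum>j<m + n. f j) = (\<Sum>j<m. f j) + (\<Sum>l<n. f (m + l))" for m n :: nat
    by (induction n) (simp_all add: ac_simps)
  with Suc show ?case by simp
qed simp

text \<open>Keeping \<open>p = 0\<close> in the same formula treats coordinates of the full
  logarithmic order together with those of lower order.\<close>

lemma inverse_ln_power_tendsto:
  "(\<lambda>n. 1 / complex_of_real (ln (real n) ^ p)) \<longlonglongrightarrow> (if p = 0 then 1 else 0)"
proof (cases "p = 0")
  case False
  have "filterlim (\<lambda>n. ln (real n) ^ p) at_top sequentially"
    using False by (intro filterlim_pow_at_top) (simp, real_asymp)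
  then have "(\<lambda>n. inverse (ln (real n) ^ p)) \<longlonglongrightarrow> 0"
    by (rule tendsto_inverse_0_at_top)
  from tendsto_of_real[OF this, where 'a = complex] False show ?thesis by (simp add: inverse_eq_divide)
qed simp

section \<open>Recursion and growth along Jordan chains\<close>

text \<open>The increments of \<open>N\<close> model the martingale differences. Since only \<open>N\<close> itself is
  controlled, the recursion is studied for \<open>S - N\<close>.\<close>
locale perturbed_system =
  fixes k :: nat and B T Tinv Jf :: "complex mat" and S N :: "nat \<Rightarrow> nat \<Rightarrow> complex"
    and \<eta> \<beta> :: real
  assumes B: "B \<in> carrier_mat k k" and T: "T \<in> carrier_mat k k"
    and Tinv: "Tinv \<in> carrier_mat k k" and Jf: "Jf \<in> carrier_mat k k"
    and T_Tinv: "T * Tinv = 1\<^sub>m k" and BT: "B * T = T - T * Jf"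
    and rec: "\<And>n v. 1 \<le> n \<Longrightarrow> v < k \<Longrightarrow> S (Suc n) v =
      S n v + (\<Sum>i<k. S n i * B $$ (i, v)) / of_nat n + (N (Suc n) v - N n v)"
    and N_bound: "\<And>v. v < k \<Longrightarrow> eventually (\<lambda>n. norm (N n v) \<le> real n powr \<beta>) sequentially"
    and \<eta>: "0 < \<eta>" and \<beta>: "\<beta> < \<eta>"
begin

definition y :: "nat \<Rightarrow> nat \<Rightarrow> complex" where
  "y c n = (\<Sum>v<k. (S n v - N n v) * T $$ (v, c))"

text \<open>The forcing that remains when \<open>S\<close> in the drift is split into
  \<open>(S - N) + N\<close>.\<close>

definition f :: "nat \<Rightarrow> nat \<Rightarrow> complex" where
  "f c n = (\<Sum>i<k. N n i * (B * T) $$ (i, c))"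

lemma mat_mult_entry:
  assumes "A \<in> carrier_mat k k" "C \<in> carrier_mat k k" "i < k" "j < k"
  shows "(A * C) $$ (i, j) = (\<Sum>l<k. A $$ (i, l) * C $$ (l, j))"
  using assms by (auto simp: scalar_prod_def atLeast0LessThan intro!: sum.cong)

text \<open>The increments of \<open>N\<close> cancel in \<open>S - N\<close>, and
  \<open>B * T = T - T * Jf\<close> carries the drift over to the new coordinates.\<close>

lemma y_rec:
  assumes "1 \<le> n" "c < k"
  shows "y c (Suc n) = y c n + (y c n - (\<Sum>i<k. y i n * Jf $$ (i, c)) + f c n) / of_nat n"
proof -
  define R where "R = (\<lambda>v. S n v - N n v)"
  have "y c (Suc n) = (\<Sum>v<k. (R v + (\<Sum>i<k. S n i * B $$ (i, v)) / of_nat n) * T $$ (v, c))"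
    unfolding y_def R_def using rec[OF assms(1)] by (intro sum.cong) auto
  also have "\<dots> = y c n + (\<Sum>v<k. (\<Sum>i<k. S n i * B $$ (i, v)) * T $$ (v, c)) / of_nat n"
    by (simp add: y_def R_def distrib_right sum.distrib flip: sum_divide_distrib)
  also have "(\<Sum>v<k. (\<Sum>i<k. S n i * B $$ (i, v)) * T $$ (v, c)) =
      (\<Sum>i<k. S n i * (\<Sum>v<k. B $$ (i, v) * T $$ (v, c)))"
    unfolding sum_distrib_left sum_distrib_right by (subst sum.swap) (simp add: mult.assoc)
  also have "\<dots> = (\<Sum>i<k. S n i * (B * T) $$ (i, c))"
    using assms by (intro sum.cong) (simp_all add: mat_mult_entry[OF B T])
  also have "\<dots> = (\<Sum>i<k. R i * (B * T) $$ (i, c)) + f c n"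
    by (simp add: f_def R_def left_diff_distrib sum_subtractf)
  also have "(\<Sum>i<k. R i * (B * T) $$ (i, c)) =
      (\<Sum>i<k. R i * (T $$ (i, c) - (\<Sum>j<k. T $$ (i, j) * Jf $$ (j, c))))"
  proof (intro sum.cong refl arg_cong[of _ _ "(*) (R _)"])
    fix i assume "i \<in> {..<k}"
    then show "(B * T) $$ (i, c) = T $$ (i, c) - (\<Sum>j<k. T $$ (i, j) * Jf $$ (j, c))"
      unfolding BT using assms T Jf mat_mult_entry[OF T Jf, of i c] by (subst index_minus_mat) auto
  qed
  also have "\<dots> = y c n - (\<Sum>i<k. \<Sum>j<k. R i * T $$ (i, j) * Jf $$ (j, c))"
    by (simp add: y_def R_def right_diff_distrib sum_subtractf sum_distrib_left mult.assoc)
  also have "(\<Sum>i<k. \<Sum>j<k. R i * T $$ (i, j) * Jf $$ (j, c)) = (\<Sum>j<k. y j n * Jf $$ (j, c))"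
    by (subst sum.swap) (simp add: y_def R_def sum_distrib_right)
  finally show ?thesis .
qed

lemma N_combination_bound:
  "\<exists>C. eventually (\<lambda>n. norm (\<Sum>i<k. N n i * a i) \<le> C * real n powr \<beta>) sequentially"
proof
  have "eventually (\<lambda>n. \<forall>i\<in>{..<k}. norm (N n i) \<le> real n powr \<beta>) sequentially"
    using N_bound by (simp add: eventually_ball_finite_distrib)
  then show "eventually (\<lambda>n. norm (\<Sum>i<k. N n i * a i) \<le> (\<Sum>i<k. norm (a i)) * real n powr \<beta>) sequentially"
  proof eventually_elim
    case (elim n)
    have "norm (\<Sum>i<k. N n i * a i) \<le> (\<Sum>i<k. norm (N n i * a i))" by (rule norm_sum)
    also have "\<dots> \<le> (\<Sum>i<k. real n powr \<beta> * norm (a i))"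
      using elim by (intro sum_mono) (simp add: norm_mult mult_right_mono)
    finally show ?case by (simp add: sum_distrib_left sum_distrib_right mult.commute)
  qed
qed

lemma null_of_bound:
  assumes "eventually (\<lambda>n. norm (h n) \<le> C * real n powr \<beta>) sequentially"
  shows "(\<lambda>n. h n / complex_of_real (real n powr \<eta>)) \<longlonglongrightarrow> 0"
proof (rule Lim_null_comparison)
  show "eventually (\<lambda>n. norm (h n / complex_of_real (real n powr \<eta>)) \<le> C * real n powr (\<beta> - \<eta>)) sequentially"
    using assms eventually_gt_at_top[of 0]
    by eventually_elim (simp add: norm_divide powr_diff divide_right_mono)
  have "(\<lambda>n. real n powr (\<beta> - \<eta>)) \<longlonglongrightarrow> 0" using \<beta> by real_asymp
  then show "(\<lambda>n. C * real n powr (\<beta> - \<eta>)) \<longlonglongrightarrow> 0"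
    using tendsto_mult_right_zero by blast
qed

lemma null_div_rising:
  assumes "(\<lambda>n. h n / complex_of_real (real n powr \<eta>)) \<longlonglongrightarrow> 0" "Re z = \<eta>"
  shows "(\<lambda>n. h n / rising_factor z n) \<longlonglongrightarrow> 0"
proof -
  have z: "0 < Re z" using assms \<eta> by simp
  have "(\<lambda>n. norm (h n / complex_of_real (real n powr \<eta>)) *
      inverse (norm (rising_factor z n) / real n powr \<eta>)) \<longlonglongrightarrow> 0 * inverse (norm (rGamma z))"
    using norm_rising_factor_asymp[OF z] rGamma_nonzero[OF z] assms(2)
    by (intro tendsto_mult tendsto_norm_zero assms tendsto_inverse) auto
  then have "(\<lambda>n. norm (h n / complex_of_real (real n powr \<eta>)) *
      inverse (norm (rising_factor z n) / real n powr \<eta>)) \<longlonglongrightarrow> 0"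
    by simp
  then have "(\<lambda>n. norm (h n / rising_factor z n)) \<longlonglongrightarrow> 0"
    by (rule Lim_transform_eventually, intro eventually_mono[OF eventually_gt_at_top[of 0]])
      (simp add: norm_divide)
  then show ?thesis by (simp add: tendsto_norm_zero_iff)
qed

text \<open>Columns \<open>c, \<dots>, c + r\<close> of \<open>Jf\<close> form the initial segment of a Jordan block of \<open>I - B\<close>
  whose eigenvalue is \<open>1 - \<mu>\<close>.\<close>
definition chain :: "complex \<Rightarrow> nat \<Rightarrow> nat \<Rightarrow> bool" where
  "chain \<mu> c r \<longleftrightarrow> c + r < k \<and> (\<forall>r'\<le>r. \<forall>i<k. Jf $$ (i, c + r') =
     (if i = c + r' then 1 - \<mu> else if 0 < r' \<and> Suc i = c + r' then 1 else 0))"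

lemma chain_le: "chain \<mu> c r \<Longrightarrow> r' \<le> r \<Longrightarrow> chain \<mu> c r'"
  by (auto simp: chain_def)

text \<open>\<open>Jf\<close> is the Jordan form of \<open>I - B\<close>, so its superdiagonal 1
  enters with a minus sign: the previous coordinate of the block acts as additional forcing, and the
  first coordinate feels \<open>f\<close> alone.\<close>

lemma chain_recursion:
  assumes "chain \<mu> c r"
  shows "perturbed_recursion \<mu> (y (c + r))
    (\<lambda>n. f (c + r) n - (if 0 < r then y (c + r - 1) n else 0))"
proof
  fix n :: nat assume n: "1 \<le> n"
  have ck: "c + r < k" using assms by (simp add: chain_def)
  have "(\<Sum>i<k. y i n * Jf $$ (i, c + r)) =
      (\<Sum>i<k. (if i = c + r then y i n * (1 - \<mu>) else 0) + (if 0 < r \<and> i = c + r - 1 then y i n else 0))"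
    using assms by (intro sum.cong) (auto simp: chain_def)
  also have "\<dots> = y (c + r) n * (1 - \<mu>) + (if 0 < r then y (c + r - 1) n else 0)"
    using ck by (simp add: sum.distrib sum.delta cong: conj_cong)
  finally have step: "y (c + r) (Suc n) = y (c + r) n + (y (c + r) n -
      (y (c + r) n * (1 - \<mu>) + (if 0 < r then y (c + r - 1) n else 0)) + f (c + r) n) / of_nat n"
    using y_rec[OF n ck] by simp
  have "Y + (Y - (Y * (1 - \<mu>) + q) + F) / of_nat n = (1 + \<mu> / of_nat n) * Y + (F - q) / of_nat n"
    for Y q F :: complex
    using n by (simp add: field_simps)
  from step[unfolded this]
  show "y (c + r) (Suc n) = (1 + \<mu> / of_nat n) * y (c + r) n +
      (f (c + r) n - (if 0 < r then y (c + r - 1) n else 0)) / of_nat n" .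
qed

lemma f_null: "(\<lambda>n. f c n / complex_of_real (real n powr \<eta>)) \<longlonglongrightarrow> 0"
  using N_combination_bound[of "\<lambda>i. (B * T) $$ (i, c)"] null_of_bound
  by (auto simp: f_def)

text \<open>Induction along the block: the previous coordinate is already
  \<open>o(n powr \<eta>)\<close>, hence admissible forcing for \<open>subcritical\<close>.\<close>

lemma chain_subcritical:
  assumes "chain \<mu> c r" "Re \<mu> < \<eta>"
  shows "(\<lambda>n. y (c + r) n / complex_of_real (real n powr \<eta>)) \<longlonglongrightarrow> 0"
  using assms(1)
proof (induction r)
  case 0
  interpret perturbed_recursion \<mu> "y (c + 0)" "\<lambda>n. f (c + 0) n - (if 0 < (0::nat) then y (c + 0 - 1) n else 0)"
    by (rule chain_recursion[OF 0])
  show ?case by (rule subcritical[OF \<eta> assms(2)]) (use f_null[of c] in simp)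
next
  case (Suc r)
  interpret perturbed_recursion \<mu> "y (c + Suc r)" "\<lambda>n. f (c + Suc r) n - (if 0 < Suc r then y (c + Suc r - 1) n else 0)"
    by (rule chain_recursion[OF Suc.prems])
  have "(\<lambda>n. y (c + r) n / complex_of_real (real n powr \<eta>)) \<longlonglongrightarrow> 0"
    using Suc chain_le[of \<mu> c "Suc r" r] by simp
  from tendsto_diff[OF f_null this] show ?case
    by (intro subcritical[OF \<eta> assms(2)]) (simp add: diff_divide_distrib)
qed

text \<open>The first coordinate is driven by \<open>f = O(n powr \<beta>)\<close> alone, so
  \<open>critical_base\<close> applies. Each later one is driven by its predecessor, and summing
  \<open>ln n ^ r / n\<close> adds one power of the logarithm.\<close>

lemma chain_critical:
  assumes "chain \<mu> c r" "Re \<mu> = \<eta>"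
  shows "\<exists>L. (\<lambda>n. y (c + r) n / (rising_factor \<mu> n * of_real (ln (real n) ^ r))) \<longlonglongrightarrow> L"
  using assms(1)
proof (induction r)
  case 0
  interpret perturbed_recursion \<mu> "y (c + 0)" "\<lambda>n. f (c + 0) n - (if 0 < (0::nat) then y (c + 0 - 1) n else 0)"
    by (rule chain_recursion[OF 0])
  obtain C where "eventually (\<lambda>n. norm (f c n) \<le> C * real n powr \<beta>) sequentially"
    using N_combination_bound[of "\<lambda>i. (B * T) $$ (i, c)"] by (auto simp: f_def)
  then show ?case
    using critical_base[of C \<beta>] assms(2) \<eta> \<beta> by (simp add: convergent_def)
next
  case (Suc r)
  interpret perturbed_recursion \<mu> "y (c + Suc r)" "\<lambda>n. f (c + Suc r) n - (if 0 < Suc r then y (c + Suc r - 1) n else 0)"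
    by (rule chain_recursion[OF Suc.prems])
  have "\<exists>L. (\<lambda>n. y (c + r) n / (rising_factor \<mu> n * of_real (ln (real n) ^ r))) \<longlonglongrightarrow> L"
    using Suc chain_le[of \<mu> c "Suc r" r] by simp
  then obtain L where L: "(\<lambda>n. y (c + r) n / (rising_factor \<mu> n * of_real (ln (real n) ^ r))) \<longlonglongrightarrow> L" ..
  \<comment> \<open>\<open>f\<close> is already negligible against the rising factor, so only the
    predecessor survives and the normalised forcing tends to \<open>- L\<close>.\<close>
  have "(\<lambda>n. f (c + Suc r) n / rising_factor \<mu> n * (1 / of_real (ln (real n) ^ r))) \<longlonglongrightarrow>
      0 * (if r = 0 then 1 else 0)"
    by (intro tendsto_mult inverse_ln_power_tendsto null_div_rising f_null assms)
  from tendsto_diff[OF this L] show ?case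
    using critical_step[of r "- L"] assms(2) \<eta> by (auto simp: diff_divide_distrib)
qed

lemma exp_ln_split:
  assumes "Re \<mu> = \<eta>" "0 < n"
  shows "exp (\<mu> * of_real (ln (real n))) =
    of_real (real n powr \<eta>) * exp (\<i> * of_real (Im \<mu> * ln (real n)))"
proof -
  have "\<mu> * of_real (ln (real n)) = of_real (\<eta> * ln (real n)) + \<i> * of_real (Im \<mu> * ln (real n))"
    using assms(1) by (simp add: complex_eq_iff)
  then have "exp (\<mu> * of_real (ln (real n))) =
      of_real (exp (\<eta> * ln (real n))) * exp (\<i> * of_real (Im \<mu> * ln (real n)))"
    by (simp only: exp_add exp_of_real)
  then show ?thesis using assms(2) by (simp add: powr_def)
qed

text \<open>Replacing the rising factor by \<open>exp (\<mu> * ln n)\<close> multiplies the limit by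
  \<open>rGamma \<mu>\<close>; a surplus power of the logarithm sends it to 0.\<close>

lemma chain_limit:
  assumes "chain \<mu> c r" "Re \<mu> = \<eta>" "r \<le> p"
  obtains L where
    "(\<lambda>n. y (c + r) n / (exp (\<mu> * of_real (ln (real n))) * of_real (ln (real n) ^ p))) \<longlonglongrightarrow> L"
    "r < p \<Longrightarrow> L = 0"
proof -
  obtain L where L: "(\<lambda>n. y (c + r) n / (rising_factor \<mu> n * of_real (ln (real n) ^ r))) \<longlonglongrightarrow> L"
    using chain_critical[OF assms(1,2)] ..
  have z: "0 < Re \<mu>" using assms \<eta> by simp
  have "(\<lambda>n. y (c + r) n / (rising_factor \<mu> n * of_real (ln (real n) ^ r)) *
      (rising_factor \<mu> n / exp (\<mu> * of_real (ln (real n)))) * (1 / of_real (ln (real n) ^ (p - r))))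
      \<longlonglongrightarrow> L * rGamma \<mu> * (if p - r = 0 then 1 else 0)"
    by (intro tendsto_mult L inverse_ln_power_tendsto rising_factor_asymp z)
  moreover have "y (c + r) n / (rising_factor \<mu> n * of_real (ln (real n) ^ r)) *
      (rising_factor \<mu> n / exp (\<mu> * of_real (ln (real n)))) * (1 / of_real (ln (real n) ^ (p - r))) =
      y (c + r) n / (exp (\<mu> * of_real (ln (real n))) * of_real (ln (real n) ^ p))" for n
  proof -
    have "ln (real n) ^ p = ln (real n) ^ r * ln (real n) ^ (p - r)"
      using assms(3) by (simp flip: power_add)
    then show ?thesis using rising_factor_nonzero[OF z, of n] by (simp add: field_simps)
  qed
  ultimately show ?thesis using that[of "L * rGamma \<mu> * (if p - r = 0 then 1 else 0)"] by auto
qed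

lemma N_combination_null:
  "(\<lambda>n. (\<Sum>i<k. N n i * a i) / of_real (real n powr \<eta> * ln (real n) ^ p)) \<longlonglongrightarrow> 0"
proof -
  have "(\<lambda>n. (\<Sum>i<k. N n i * a i) / of_real (real n powr \<eta>)) \<longlonglongrightarrow> 0"
    using N_combination_bound[of a] null_of_bound by auto
  from tendsto_mult[OF this inverse_ln_power_tendsto[of p]] show ?thesis by simp
qed

lemma S_decomposition:
  assumes "v < k"
  shows "S n v = (\<Sum>c<k. y c n * Tinv $$ (c, v)) + N n v"
proof -
  have "(\<Sum>c<k. y c n * Tinv $$ (c, v)) = (\<Sum>i<k. (S n i - N n i) * (\<Sum>c<k. T $$ (i, c) * Tinv $$ (c, v)))"
    unfolding y_def sum_distrib_left sum_distrib_right by (subst sum.swap) (simp add: mult.assoc)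
  also have "\<dots> = (\<Sum>i<k. (S n i - N n i) * 1\<^sub>m k $$ (i, v))"
    using assms by (intro sum.cong) (simp_all flip: T_Tinv add: mat_mult_entry[OF T Tinv])
  also have "\<dots> = (\<Sum>i<k. if i = v then S n i - N n i else 0)"
    using assms by (intro sum.cong) auto
  also have "\<dots> = S n v - N n v" using assms by (simp add: sum.delta)
  finally show ?thesis by simp
qed

end

section \<open>Assembling all Jordan parts\<close>

locale jordan_system = perturbed_system +
  fixes s :: nat and lam :: "nat \<Rightarrow> complex" and J :: "nat \<Rightarrow> complex mat"
    and nu_of :: "nat \<Rightarrow> nat" and \<nu> :: nat
  assumes Jf_eq: "Jf = diag_block_mat (map J [0..<s])"
    and part: "\<And>t. t < s \<Longrightarrow> is_jordan_part (1 - lam t) (J t)"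
    and J_carrier: "\<And>t. t < s \<Longrightarrow> J t \<in> carrier_mat (nu_of t) (nu_of t)"
    and Re_lam_le: "\<And>t. t < s \<Longrightarrow> Re (lam t) \<le> \<eta>"
    and nu_of_le: "\<And>t. t < s \<Longrightarrow> Re (lam t) = \<eta> \<Longrightarrow> nu_of t \<le> \<nu>"
begin

abbreviation offset :: "nat \<Rightarrow> nat" where
  "offset t \<equiv> \<Sum>t'<t. nu_of t'"

lemma dim_row_J: "t < s \<Longrightarrow> dim_row (J t) = nu_of t" "t < s \<Longrightarrow> dim_col (J t) = nu_of t"
  using J_carrier by auto

lemma sum_list_nu_of: "t \<le> s \<Longrightarrow> sum_list (map dim_row (map J [0..<t])) = offset t"
proof -
  assume "t \<le> s"
  then have "map dim_row (map J [0..<t]) = map nu_of [0..<t]" by (simp add: dim_row_J)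
  then show ?thesis
    by (simp only: interv_sum_list_conv_sum_set_nat) (simp add: atLeast0LessThan)
qed

lemma k_eq: "k = offset s"
proof -
  have "k = dim_row Jf" using Jf by simp
  then show ?thesis
    unfolding Jf_eq dim_diag_block_mat using sum_list_nu_of[of s] by simp
qed

lemma offset_add_less:
  assumes "t < s" "l < nu_of t"
  shows "offset t + l < k"
proof -
  have "offset (Suc t) \<le> offset s" using assms by (intro sum_mono2) auto
  then show ?thesis using assms k_eq by simp
qed

text \<open>Every coordinate of a part lies in one of its blocks, at depth \<open>r\<close>. With
  several blocks \<open>r\<close> can be smaller than the position \<open>l\<close> in the part, so
  the last coordinate of a large part need not attain the full logarithmic order.\<close>

lemma position_chain:
  assumes t: "t < s" and l: "l < nu_of t"
  obtains r where "r \<le> l" "chain (lam t) (offset t + (l - r)) r"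
proof -
  obtain ns where ns: "J t = jordan_matrix (map (\<lambda>m. (m, 1 - lam t)) ns)"
    using part[OF t] unfolding is_jordan_part_def by blast
  have sum_ns: "sum_list ns = nu_of t"
    using dim_row_J[OF t] unfolding ns by (simp add: comp_def)
  obtain r where r: "r \<le> l" and col: "\<And>r' i. r' \<le> r \<Longrightarrow> i < nu_of t \<Longrightarrow>
      J t $$ (i, l - r + r') =
      (if i = l - r + r' then 1 - lam t else if 0 < r' \<and> Suc i = l - r + r' then 1 else 0)"
    using jordan_part_column[of l ns "1 - lam t"] l unfolding ns sum_ns by blast
  have "Jf $$ (i, offset t + (l - r) + r') =
      (if i = offset t + (l - r) + r' then 1 - lam t
       else if 0 < r' \<and> Suc i = offset t + (l - r) + r' then 1 else 0)"
    if "r' \<le> r" "i < k" for r' i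
  proof -
    have c: "l - r + r' < nu_of t" using that r l by simp
    have off: "sum_list (map dim_row (take t (map J [0..<s]))) = offset t"
      using sum_list_nu_of[of t] t by (simp add: take_map)
    have nth: "map J [0..<s] ! t = J t" using t by simp
    have sq: "dim_col A = dim_row A" if "A \<in> set (map J [0..<s])" for A
      using that by (auto simp: dim_row_J)
    have "Jf $$ (i, offset t + (l - r + r')) =
        (if offset t \<le> i \<and> i < offset t + nu_of t then J t $$ (i - offset t, l - r + r') else 0)"
      using diag_block_mat_column[OF sq, of "map J [0..<s]" t "l - r + r'" i] t c that(2) Jf
      unfolding off nth by (simp add: dim_row_J Jf_eq[symmetric])
    also have "\<dots> = (if i = offset t + (l - r) + r' then 1 - lam t
       else if 0 < r' \<and> Suc i = offset t + (l - r) + r' then 1 else 0)"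
    proof (cases "offset t \<le> i \<and> i < offset t + nu_of t")
      case True
      then have "i - offset t < nu_of t"
        "i - offset t = l - r + r' \<longleftrightarrow> i = offset t + (l - r) + r'"
        "Suc (i - offset t) = l - r + r' \<longleftrightarrow> Suc i = offset t + (l - r) + r'" by auto
      with True col[OF that(1)] show ?thesis by presburger
    next
      case False
      then show ?thesis using c by auto
    qed
    finally show ?thesis by (simp add: add.assoc)
  qed
  moreover have "offset t + (l - r) + r < k" using offset_add_less[OF t l] r by simp
  ultimately show ?thesis using that[OF r] unfolding chain_def by blast
qed

definition scale :: "nat \<Rightarrow> complex" where
  "scale n = of_real (real n powr \<eta> * ln (real n) ^ (\<nu> - 1))"

definition rotation :: "nat \<Rightarrow> nat \<Rightarrow> complex" where
  "rotation t n = exp (\<i> * of_real (Im (lam t) * ln (real n)))"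

text \<open>Columns are numbered from 0, so the last column of part \<open>t\<close> is one less
  than the accumulated multiplicity.\<close>

definition final :: "nat \<Rightarrow> nat" where
  "final t = (\<Sum>j\<le>t. nu_of j) - 1"

text \<open>The case \<open>\<nu> = 0\<close> cannot occur for genuine Jordan data, but the assumptions of the locale allow
  it, and then \<open>final t\<close> need not be a valid index.\<close>
definition \<Xi> :: "nat \<Rightarrow> complex" where
  "\<Xi> t = (if \<nu> = 0 then 0 else lim (\<lambda>n. (\<Sum>v<k. S n v * T $$ (v, final t)) /
     (exp (lam t * of_real (ln (real n))) * of_real (ln (real n) ^ (\<nu> - 1)))))"

text \<open>\<open>exp (lam t * ln n)\<close> is \<open>n powr \<eta>\<close> times a unimodular
  rotation, so multiplying the error by the rotation leaves its modulus unchanged.\<close>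

lemma y_over_scale_critical:
  assumes "Re (lam t) = \<eta>"
    and L: "(\<lambda>n. h n / (exp (lam t * of_real (ln (real n))) * of_real (ln (real n) ^ (\<nu> - 1)))) \<longlonglongrightarrow> L"
  shows "(\<lambda>n. h n / scale n - rotation t n * L) \<longlonglongrightarrow> 0"
proof -
  let ?h = "\<lambda>n. h n / (exp (lam t * of_real (ln (real n))) * of_real (ln (real n) ^ (\<nu> - 1)))"
  have "(\<lambda>n. norm (?h n - L)) \<longlonglongrightarrow> 0" using L by (intro tendsto_norm_zero LIM_zero)
  then have "(\<lambda>n. norm (h n / scale n - rotation t n * L)) \<longlonglongrightarrow> 0"
  proof (rule Lim_transform_eventually)
    show "eventually (\<lambda>n. norm (?h n - L) = norm (h n / scale n - rotation t n * L)) sequentially"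
      using eventually_gt_at_top[of 0]
    proof eventually_elim
      case (elim n)
      have "h n / scale n - rotation t n * L = rotation t n * (?h n - L)"
        unfolding exp_ln_split[OF assms(1) elim] scale_def rotation_def
        by (simp add: right_diff_distrib)
      then show ?case by (simp add: norm_mult rotation_def)
    qed
  qed
  then show ?thesis by (simp add: tendsto_norm_zero_iff)
qed

text \<open>A critical coordinate has logarithmic order at most its depth \<open>r\<close>, and
  \<open>r \<le> l \<le> \<nu> - 1\<close>. Hence only \<open>l = \<nu> - 1\<close> in a part of
  size \<open>\<nu>\<close> can survive; if there \<open>r < \<nu> - 1\<close> because the part has
  several blocks, \<open>\<Xi> t\<close> is 0.\<close>

lemma position_limit:
  assumes t: "t < s" and l: "l < nu_of t"
  shows "(\<lambda>n. y (offset t + l) n / scale n -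
    (if Re (lam t) = \<eta> \<and> nu_of t = \<nu> \<and> l = \<nu> - 1 then rotation t n * \<Xi> t else 0)) \<longlonglongrightarrow> 0"
proof -
  obtain r where r: "r \<le> l" and ch: "chain (lam t) (offset t + (l - r)) r"
    using position_chain[OF assms] .
  have pos: "offset t + (l - r) + r = offset t + l" using r by simp
  show ?thesis
  proof (cases "Re (lam t) = \<eta>")
    case False
    then have "(\<lambda>n. y (offset t + l) n / of_real (real n powr \<eta>)) \<longlonglongrightarrow> 0"
      using chain_subcritical[OF ch] Re_lam_le[OF t] by (simp add: pos)
    from tendsto_mult[OF this inverse_ln_power_tendsto[of "\<nu> - 1"]] False show ?thesis
      by (simp add: scale_def)
  next
    case True
    then have \<nu>: "l < \<nu>" "nu_of t \<le> \<nu>" using nu_of_le[OF t] l by auto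
    then have "r \<le> \<nu> - 1" using r by simp
    then obtain L where
      L: "(\<lambda>n. y (offset t + l) n / (exp (lam t * of_real (ln (real n))) * of_real (ln (real n) ^ (\<nu> - 1)))) \<longlonglongrightarrow> L"
      and L0: "r < \<nu> - 1 \<Longrightarrow> L = 0"
      using chain_limit[OF ch True] unfolding pos by blast
    note lim = y_over_scale_critical[OF True L]
    show ?thesis
    proof (cases "nu_of t = \<nu> \<and> l = \<nu> - 1")
      case False
      then have "L = 0" using L0 r l \<nu> by linarith
      with lim False show ?thesis by auto
    next
      case last: True
      then have fin: "final t = offset t + l"
        using \<nu> by (simp add: final_def flip: lessThan_Suc_atMost)
      \<comment> \<open>\<open>\<Xi> t\<close> is read off from \<open>S\<close>, whereas
        \<open>L\<close> comes from \<open>S - N\<close>; they agree because the combination of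
        \<open>N\<close> is negligible at this scale.\<close>
      have "(\<lambda>n. (\<Sum>v<k. N n v * T $$ (v, final t)) / scale n) \<longlonglongrightarrow> 0"
        unfolding scale_def by (rule N_combination_null)
      then have "(\<lambda>n. norm ((\<Sum>v<k. N n v * T $$ (v, final t)) / scale n)) \<longlonglongrightarrow> 0"
        by (rule tendsto_norm_zero)
      then have "(\<lambda>n. norm ((\<Sum>v<k. N n v * T $$ (v, final t)) /
          (exp (lam t * of_real (ln (real n))) * of_real (ln (real n) ^ (\<nu> - 1))))) \<longlonglongrightarrow> 0"
        by (rule Lim_transform_eventually, intro eventually_mono[OF eventually_gt_at_top[of 0]])
          (simp add: exp_ln_split[OF True] scale_def norm_divide norm_mult)
      then have "(\<lambda>n. (\<Sum>v<k. N n v * T $$ (v, final t)) /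
          (exp (lam t * of_real (ln (real n))) * of_real (ln (real n) ^ (\<nu> - 1)))) \<longlonglongrightarrow> 0"
        by (simp only: tendsto_norm_zero_iff)
      from tendsto_add[OF L this] have
        "(\<lambda>n. (y (offset t + l) n + (\<Sum>v<k. N n v * T $$ (v, final t))) /
          (exp (lam t * of_real (ln (real n))) * of_real (ln (real n) ^ (\<nu> - 1)))) \<longlonglongrightarrow> L"
        by (simp add: add_divide_distrib)
      moreover have "y (offset t + l) n + (\<Sum>v<k. N n v * T $$ (v, final t)) =
          (\<Sum>v<k. S n v * T $$ (v, final t))" for n
        unfolding y_def fin by (simp add: left_diff_distrib sum_subtractf)
      ultimately have "\<Xi> t = L" using \<nu> by (simp add: \<Xi>_def limI)
      with lim last True show ?thesis by simp
    qed
  qed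
qed

text \<open>\<open>S\<close> is expanded over the rows of \<open>Tinv\<close>, grouped by parts. By
  \<open>position_limit\<close> at most the final row of each critical part of size
  \<open>\<nu>\<close> remains, and \<open>row_mult\<close> with a unit vector extracts that
  row.\<close>

lemma limit:
  assumes v: "v < k"
  shows "(\<lambda>n. S n v / scale n - (\<Sum>t | t < s \<and> Re (lam t) = \<eta> \<and> nu_of t = \<nu>.
    rotation t n * \<Xi> t * row_mult (unit_vec k (final t)) Tinv $ v)) \<longlonglongrightarrow> 0"
proof -
  let ?P = "\<lambda>t. Re (lam t) = \<eta> \<and> nu_of t = \<nu>"
  let ?c = "\<lambda>t n. rotation t n * \<Xi> t"
  let ?D = "\<lambda>t l n. y (offset t + l) n / scale n - (if Re (lam t) = \<eta> \<and> nu_of t = \<nu> \<and> l = \<nu> - 1 then ?c t n else 0)"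
  have "(\<lambda>n. (\<Sum>t<s. \<Sum>l<nu_of t. ?D t l n * Tinv $$ (offset t + l, v)) + N n v / scale n)
      \<longlonglongrightarrow> (\<Sum>t<s. \<Sum>l<nu_of t. 0 * Tinv $$ (offset t + l, v)) + 0"
  proof (intro tendsto_add tendsto_sum tendsto_mult tendsto_const position_limit)
    have "(\<lambda>n. (\<Sum>i<k. N n i * (if i = v then 1 else 0)) / scale n) \<longlonglongrightarrow> 0"
      unfolding scale_def by (rule N_combination_null)
    also have "(\<lambda>n. \<Sum>i<k. N n i * (if i = v then 1 else 0)) = (\<lambda>n. N n v)"
      using v by (simp add: if_distrib sum.delta cong: if_cong)
    finally show "(\<lambda>n. N n v / scale n) \<longlonglongrightarrow> 0" .
  qed auto
  moreover have "(\<Sum>t<s. \<Sum>l<nu_of t. ?D t l n * Tinv $$ (offset t + l, v)) + N n v / scale n =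
      S n v / scale n - (\<Sum>t | t < s \<and> ?P t. ?c t n * row_mult (unit_vec k (final t)) Tinv $ v)" for n
  proof -
    have "(\<Sum>l<nu_of t. (if ?P t \<and> l = \<nu> - 1 then ?c t n else 0) * Tinv $$ (offset t + l, v)) =
        (if ?P t then ?c t n * row_mult (unit_vec k (final t)) Tinv $ v else 0)" if t: "t < s" for t
    \<comment> \<open>For \<open>\<nu> = 0\<close> a selected part is empty, so the left side is an
      empty sum, and the right side vanishes because \<open>\<Xi> t = 0\<close>.\<close>
    proof (cases "?P t \<and> \<nu> \<noteq> 0")
      case True
      then have fin: "final t = offset t + (\<nu> - 1)"
        by (simp add: final_def flip: lessThan_Suc_atMost)
      have "final t < k" unfolding fin using True t by (intro offset_add_less) auto
      then have "row_mult (unit_vec k (final t)) Tinv $ v = Tinv $$ (final t, v)"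
        using v Tinv by (simp add: row_mult_def)
      moreover have "(\<Sum>l<nu_of t. (if ?P t \<and> l = \<nu> - 1 then ?c t n else 0) * Tinv $$ (offset t + l, v)) =
          (\<Sum>l<nu_of t. if l = \<nu> - 1 then ?c t n * Tinv $$ (offset t + l, v) else 0)"
        using True by (intro sum.cong) auto
      ultimately show ?thesis using True by (simp add: sum.delta fin)
    qed (auto simp: \<Xi>_def)
    then have "(\<Sum>t<s. \<Sum>l<nu_of t. (if ?P t \<and> l = \<nu> - 1 then ?c t n else 0) * Tinv $$ (offset t + l, v)) =
        (\<Sum>t<s. if ?P t then ?c t n * row_mult (unit_vec k (final t)) Tinv $ v else 0)"
      by simp
    also have "\<dots> = (\<Sum>t | t < s \<and> ?P t. ?c t n * row_mult (unit_vec k (final t)) Tinv $ v)"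
      by (subst sum.inter_filter[symmetric]) (auto intro!: sum.cong)
    finally have main: "(\<Sum>t<s. \<Sum>l<nu_of t. (if ?P t \<and> l = \<nu> - 1 then ?c t n else 0) * Tinv $$ (offset t + l, v)) = \<dots>" .
    have "(\<Sum>t<s. \<Sum>l<nu_of t. y (offset t + l) n / scale n * Tinv $$ (offset t + l, v)) =
        (\<Sum>c<k. y c n / scale n * Tinv $$ (c, v))"
      unfolding k_eq by (rule sum_blocks[symmetric])
    also have "\<dots> = (S n v - N n v) / scale n"
      using S_decomposition[OF v, of n] by (simp add: sum_divide_distrib)
    finally show ?thesis
      using main by (simp add: left_diff_distrib sum_subtractf diff_divide_distrib)
  qed
  ultimately show ?thesis by simp
qed

end

section \<open>The martingale part of the walk\<close>

text \<open>Keeping the linear term exact lets it vanish in mean for a martingale difference. For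
  negative \<open>x\<close> the bound comes from inverting the quadratic Taylor lower bound of
  \<open>exp (- x)\<close>.\<close>

lemma exp_le_quadratic:
  fixes x :: real
  assumes "\<bar>x\<bar> \<le> 1"
  shows "exp x \<le> 1 + x + x\<^sup>2"
proof (cases "0 \<le> x")
  case True
  then show ?thesis using exp_bound assms by simp
next
  case False
  define t where "t = - x"
  have t: "0 \<le> t" using False by (simp add: t_def)
  have "exp x = 1 / exp t" by (simp add: t_def exp_minus inverse_eq_divide)
  also have "\<dots> \<le> 1 / (1 + t + t\<^sup>2 / 2)"
    using exp_lower_Taylor_quadratic[OF t] t by (intro divide_left_mono mult_pos_pos) (auto intro: add_pos_nonneg)
  also have "\<dots> \<le> 1 - t + t\<^sup>2"
  proof -
    have "(1 - t + t\<^sup>2) * (1 + t + t\<^sup>2 / 2) = 1 + (t\<^sup>2 + t ^ 3 + t ^ 4) / 2"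
      by (simp add: field_simps power2_eq_square power3_eq_cube power4_eq_xxxx)
    then have "1 \<le> (1 - t + t\<^sup>2) * (1 + t + t\<^sup>2 / 2)" using t by simp
    moreover have "0 < 1 + t + t\<^sup>2 / 2" using t by (auto intro: add_pos_nonneg)
    ultimately show ?thesis by (simp add: pos_divide_le_eq)
  qed
  finally show ?thesis by (simp add: t_def)
qed

section \<open>The walk as a function of finitely many noise variables\<close>

text \<open>The step at time \<open>m + 1\<close> consumes the noise of time \<open>m\<close>, so
  the steps up to time \<open>n\<close> need only noise of times below \<open>n\<close> and the
  initial signs.\<close>

definition past_indices :: "nat \<Rightarrow> nat \<Rightarrow> noise_index set" where
  "past_indices k n = {Sig v | v. v < k} \<union> {Xi m v | m v. m \<in> {1..<n} \<and> v < k} \<union>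
     {Mem m v | m v. m \<in> {1..<n} \<and> v < k} \<union> {Nbr m v | m v. m \<in> {1..<n} \<and> v < k}"

lemma finite_past_indices: "finite (past_indices k n)"
proof -
  have "past_indices k n = Sig ` {..<k} \<union> (\<lambda>(m, v). Xi m v) ` ({1..<n} \<times> {..<k}) \<union>
      (\<lambda>(m, v). Mem m v) ` ({1..<n} \<times> {..<k}) \<union> (\<lambda>(m, v). Nbr m v) ` ({1..<n} \<times> {..<k})"
    unfolding past_indices_def by auto
  then show ?thesis by simp
qed

text \<open>The walk as a function of the noise array itself, with sample space
  \<open>noise_index \<Rightarrow> int\<close>. On the null set where some neighbour is not a vertex, the step
  \<open>erwg_step\<close> of the model need not be measurable; this version always is.\<close>
definition path_step :: "nat \<Rightarrow> nat \<Rightarrow> (noise_index \<Rightarrow> int) \<Rightarrow> int" where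
  "path_step = erwg_step (\<lambda>v z. z (Sig v)) (\<lambda>n v z. z (Xi n v))
     (\<lambda>n v z. nat (z (Mem n v))) (\<lambda>n v z. nat (z (Nbr n v)))"

context erwg
begin

definition past :: "nat \<Rightarrow> 'a \<Rightarrow> noise_index \<Rightarrow> int" where
  "past n \<omega> = restrict (\<lambda>i. noise \<sigma> \<xi> D u i \<omega>) (past_indices k n)"

abbreviation X :: "nat \<Rightarrow> nat \<Rightarrow> 'a \<Rightarrow> int" where
  "X \<equiv> erwg_step \<sigma> \<xi> D u"

text \<open>Collects the almost sure range restrictions on the noise, so that the bounds on the
  steps can be proved pathwise.\<close>

definition good :: "'a \<Rightarrow> bool" where
  "good \<omega> \<longleftrightarrow> (\<forall>v<k. \<sigma> v \<omega> \<in> {-1, 1}) \<and> (\<forall>n\<ge>1. \<forall>v<k. \<xi> n v \<omega> \<in> {-1, 1} \<and>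
     D n v \<omega> \<in> {1..n} \<and> u n v \<omega> \<in> in_nbrs E v)"

lemma in_nbrs_subset: "in_nbrs E v \<subseteq> {..<k}"
  using edges by (auto simp: in_nbrs_def)

lemma finite_in_nbrs: "finite (in_nbrs E v)"
  using in_nbrs_subset finite_subset by blast

lemma in_nbrs_nonempty: "v < k \<Longrightarrow> in_nbrs E v \<noteq> {}"
  using indegree_pos[of v] by auto

lemma noise_measurable:
  "i \<in> noise_indices k \<Longrightarrow> noise \<sigma> \<xi> D u i \<in> measurable M (count_space UNIV)"
  using indep by (auto simp: indep_vars_def)

lemma
  assumes "v < k"
  shows sigma_measurable [measurable]: "\<sigma> v \<in> measurable M (count_space UNIV)"
    and xi_measurable [measurable]: "1 \<le> n \<Longrightarrow> \<xi> n v \<in> measurable M (count_space UNIV)"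
    and D_measurable [measurable]: "1 \<le> n \<Longrightarrow> D n v \<in> measurable M (count_space UNIV)"
    and u_measurable [measurable]: "1 \<le> n \<Longrightarrow> u n v \<in> measurable M (count_space UNIV)"
proof -
  show "\<sigma> v \<in> measurable M (count_space UNIV)"
    using noise_measurable[of "Sig v"] assms by (simp add: noise_indices_def)
  assume n: "1 \<le> n"
  show "\<xi> n v \<in> measurable M (count_space UNIV)"
    using noise_measurable[of "Xi n v"] assms n by (simp add: noise_indices_def)
  have "(\<lambda>\<omega>. nat (noise \<sigma> \<xi> D u (Mem n v) \<omega>)) \<in> measurable M (count_space UNIV)"
    using noise_measurable[of "Mem n v"] assms n
    by (intro measurable_compose[OF _ measurable_count_space]) (simp add: noise_indices_def)
  then show "D n v \<in> measurable M (count_space UNIV)" by simp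
  have "(\<lambda>\<omega>. nat (noise \<sigma> \<xi> D u (Nbr n v) \<omega>)) \<in> measurable M (count_space UNIV)"
    using noise_measurable[of "Nbr n v"] assms n
    by (intro measurable_compose[OF _ measurable_count_space]) (simp add: noise_indices_def)
  then show "u n v \<in> measurable M (count_space UNIV)" by simp
qed

lemma AE_of_law:
  assumes "f \<in> measurable M (count_space UNIV)"
    and "distr M (count_space UNIV) f = measure_pmf q'" "set_pmf q' \<subseteq> A"
  shows "AE \<omega> in M. f \<omega> \<in> A"
proof -
  have "AE x in distr M (count_space UNIV) f. x \<in> A"
    unfolding assms(2) using assms(3) by (auto simp: AE_measure_pmf_iff)
  then show ?thesis using assms(1) by (simp add: AE_distr_iff)
qed

lemma set_rad_pmf: "set_pmf (rad_pmf x) \<subseteq> {-1, 1}"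
  by (auto simp: rad_pmf_def)

lemma AE_good: "AE \<omega> in M. good \<omega>"
proof -
  have "AE \<omega> in M. \<sigma> v \<omega> \<in> {-1, 1}" if "v < k" for v
    using that by (intro AE_of_law[OF _ sigma_law] set_rad_pmf) auto
  then have "AE \<omega> in M. v < k \<longrightarrow> \<sigma> v \<omega> \<in> {-1, 1}" for v by (cases "v < k") auto
  moreover have "AE \<omega> in M. \<xi> n v \<omega> \<in> {-1, 1} \<and> D n v \<omega> \<in> {1..n} \<and> u n v \<omega> \<in> in_nbrs E v"
    if "1 \<le> n" "v < k" for n v
    using that in_nbrs_nonempty finite_in_nbrs
    by (intro AE_conjI AE_of_law[OF _ xi_law] AE_of_law[OF _ D_law] AE_of_law[OF _ u_law] set_rad_pmf)
      (auto simp: set_pmf_of_set)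
  then have "AE \<omega> in M. 1 \<le> n \<longrightarrow> v < k \<longrightarrow>
      \<xi> n v \<omega> \<in> {-1, 1} \<and> D n v \<omega> \<in> {1..n} \<and> u n v \<omega> \<in> in_nbrs E v" for n v
    by (cases "1 \<le> n"; cases "v < k") auto
  ultimately show ?thesis
    unfolding good_def by (simp add: AE_all_countable AE_conj_iff)
qed

lemma past_indices_subset: "past_indices k n \<subseteq> noise_indices k"
  by (auto simp: past_indices_def noise_indices_def)

lemma past_measurable: "past n \<in> measurable M (PiM (past_indices k n) (\<lambda>_. count_space UNIV))"
  unfolding past_def[abs_def] using noise_measurable past_indices_subset
  by (intro measurable_restrict) auto

text \<open>A finite product of countable discrete spaces is discrete, so every functional of the
  past is measurable.\<close>

lemma measurable_of_path:
  fixes g :: "(noise_index \<Rightarrow> int) \<Rightarrow> 'b :: topological_space"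
  shows "g \<in> borel_measurable (PiM (past_indices k n) (\<lambda>_. count_space UNIV))"
  by (subst count_space_PiM_finite) (auto simp: finite_past_indices)

lemma measurable_past:
  fixes g :: "(noise_index \<Rightarrow> int) \<Rightarrow> 'b :: topological_space"
  shows "(\<lambda>\<omega>. g (past n \<omega>)) \<in> borel_measurable M"
  using measurable_compose[OF past_measurable measurable_of_path] .

lemma goodD:
  assumes "good \<omega>" "1 \<le> n" "v < k"
  shows "\<bar>\<xi> n v \<omega>\<bar> = 1" "D n v \<omega> \<in> {1..n}" "u n v \<omega> \<in> in_nbrs E v" "u n v \<omega> < k"
proof -
  have g: "\<xi> n v \<omega> \<in> {-1, 1} \<and> D n v \<omega> \<in> {1..n} \<and> u n v \<omega> \<in> in_nbrs E v"
    using assms unfolding good_def by blast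
  then show "\<bar>\<xi> n v \<omega>\<bar> = 1" "D n v \<omega> \<in> {1..n}" "u n v \<omega> \<in> in_nbrs E v" "u n v \<omega> < k"
    using in_nbrs_subset by auto
qed

text \<open>Strong induction in time, for all vertices at once, since a step refers back to an
  earlier step of a possibly different vertex.\<close>

lemma path_step_past:
  assumes "good \<omega>" "v < k" "d \<le> n"
  shows "path_step d v (past n \<omega>) = X d v \<omega>"
  using assms(2,3)
proof (induction d arbitrary: v rule: less_induct)
  case (less d)
  consider "d = 0" | "d = 1" | m where "d = Suc (Suc m)"
    by (metis One_nat_def not0_implies_Suc)
  then show ?case
  proof cases
    case 3
    then have m: "Suc m < n" using less.prems by simp
    have ud: "D (Suc m) v \<omega> \<in> {1..Suc m}" "u (Suc m) v \<omega> < k"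
      using goodD[OF assms(1), of "Suc m" v] less.prems by auto
    have "Xi (Suc m) v \<in> past_indices k n" "Mem (Suc m) v \<in> past_indices k n"
      "Nbr (Suc m) v \<in> past_indices k n"
      using m less.prems by (auto simp: past_indices_def)
    then have "path_step d v (past n \<omega>) =
        \<xi> (Suc m) v \<omega> * path_step (D (Suc m) v \<omega>) (u (Suc m) v \<omega>) (past n \<omega>)"
      using ud unfolding 3 path_step_def by (simp add: past_def)
    also have "path_step (D (Suc m) v \<omega>) (u (Suc m) v \<omega>) (past n \<omega>) =
        X (D (Suc m) v \<omega>) (u (Suc m) v \<omega>) \<omega>"
      using ud 3 m by (intro less.IH) auto
    finally show ?thesis using ud 3 by simp
  qed (use less.prems in \<open>auto simp: path_step_def past_def past_indices_def\<close>)
qed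

lemma abs_X_le:
  assumes "good \<omega>" "v < k"
  shows "\<bar>X d v \<omega>\<bar> \<le> 1"
  using assms(2)
proof (induction d arbitrary: v rule: less_induct)
  case (less d)
  consider "d = 0" | "d = 1" | m where "d = Suc (Suc m)"
    by (metis One_nat_def not0_implies_Suc)
  then show ?case
  proof cases
    case 2
    then show ?thesis using assms(1) less.prems by (auto simp: good_def)
  next
    case 3
    have "D (Suc m) v \<omega> \<in> {1..Suc m}" "u (Suc m) v \<omega> < k" "\<bar>\<xi> (Suc m) v \<omega>\<bar> = 1"
      using goodD[OF assms(1), of "Suc m" v] less.prems by auto
    with less.IH[of "D (Suc m) v \<omega>" "u (Suc m) v \<omega>"] 3 show ?thesis
      by (simp add: abs_mult)
  qed simp
qed

lemma expectation_of_law: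
  assumes "f \<in> measurable M (count_space UNIV)"
    and "distr M (count_space UNIV) f = measure_pmf q'"
  shows "expectation (\<lambda>\<omega>. h (f \<omega>)) = measure_pmf.expectation q' (h :: _ \<Rightarrow> real)"
  unfolding assms(2)[symmetric] using assms(1) by (subst integral_distr) auto

text \<open>The past, the sign, the memory time and the neighbour are independent, so the
  expectation factorises. Bounded test functions \<open>g\<close> of the past take the place of
  conditional expectations.\<close>

lemma step_expectation:
  fixes g :: "(noise_index \<Rightarrow> int) \<Rightarrow> real"
  assumes n: "1 \<le> n" and v: "v < k" and d: "d \<in> {1..n}" and i: "i \<in> in_nbrs E v"
    and g: "AE \<omega> in M. \<bar>g (past n \<omega>)\<bar> \<le> C"
  defines "h \<equiv> \<lambda>\<omega>. g (past n \<omega>) * (of_int (\<xi> n v \<omega>) * (of_bool (D n v \<omega> = d) * of_bool (u n v \<omega> = i)))"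
  shows "integrable M h"
    and "expectation h = expectation (\<lambda>\<omega>. g (past n \<omega>)) *
      ((2 * p v - 1) / (real n * real (card (in_nbrs E v))))"
proof -
  \<comment> \<open>Four disjoint groups of noise indices, numbered so that their independence is a
    single \<open>indep_vars\<close> statement.\<close>
  define K where "K = (\<lambda>j::nat. [past_indices k n, {Xi n v}, {Mem n v}, {Nbr n v}] ! j)"
  define Y :: "nat \<Rightarrow> (noise_index \<Rightarrow> int) \<Rightarrow> real" where
    "Y = (\<lambda>j. [g, \<lambda>z. of_int (z (Xi n v)), \<lambda>z. of_bool (z (Mem n v) = int d),
      \<lambda>z. of_bool (z (Nbr n v) = int i)] ! j)"
  define W where "W = (\<lambda>j \<omega>. Y j (restrict (\<lambda>l. noise \<sigma> \<xi> D u l \<omega>) (K j)))"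
  have less4: "{..<4} = {0, 1, 2, 3 :: nat}" by auto
  have K: "K 0 = past_indices k n" "K 1 = {Xi n v}" "K (Suc 0) = {Xi n v}" "K 2 = {Mem n v}" "K 3 = {Nbr n v}"
    by (simp_all add: K_def numeral_eq_Suc)
  have W: "W 0 = (\<lambda>\<omega>. g (past n \<omega>))" "W 1 = (\<lambda>\<omega>. of_int (\<xi> n v \<omega>))"
    "W (Suc 0) = (\<lambda>\<omega>. of_int (\<xi> n v \<omega>))"
    "W 2 = (\<lambda>\<omega>. of_bool (D n v \<omega> = d))" "W 3 = (\<lambda>\<omega>. of_bool (u n v \<omega> = i))"
    by (auto simp: W_def Y_def K_def past_def numeral_eq_Suc)
  have "indep_vars (\<lambda>j. PiM (K j) (\<lambda>_. count_space UNIV))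
      (\<lambda>j \<omega>. restrict (\<lambda>l. noise \<sigma> \<xi> D u l \<omega>) (K j)) {..<4}"
  proof (rule indep_vars_restrict[OF indep])
    show "K j \<subseteq> noise_indices k" if "j \<in> {..<4}" for j
    proof -
      have "Xi n v \<in> noise_indices k" "Mem n v \<in> noise_indices k" "Nbr n v \<in> noise_indices k"
        using n v by (auto simp: noise_indices_def)
      moreover have "j = 0 \<or> j = 1 \<or> j = 2 \<or> j = 3" using that less4 by auto
      ultimately show ?thesis using past_indices_subset[of n] by (elim disjE) (simp_all only: K, simp_all)
    qed
    have "Xi n v \<notin> past_indices k n" "Mem n v \<notin> past_indices k n" "Nbr n v \<notin> past_indices k n"
      by (auto simp: past_indices_def)
    then show "disjoint_family_on K {..<4}"
      unfolding disjoint_family_on_def less4 by (simp add: K)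
  qed
  then have ind: "indep_vars (\<lambda>_. borel) W {..<4}"
    unfolding W_def
  proof (rule indep_vars_compose2)
    fix j :: nat assume "j \<in> {..<4}"
    then have "finite (K j)"
      using finite_past_indices[of k n] unfolding less4 by (auto simp: K)
    then show "Y j \<in> borel_measurable (PiM (K j) (\<lambda>_. count_space UNIV))"
      by (subst count_space_PiM_finite) auto
  qed
  have rv: "W j \<in> borel_measurable M" if "j \<in> {..<4}" for j
    using ind that by (auto simp: indep_vars_def)
  have int: "integrable M (W j)" if j: "j \<in> {..<4}" for j
  proof -
    have "\<exists>B. AE \<omega> in M. norm (W j \<omega>) \<le> B"
    proof -
      consider "j = 0" | "j = 1" | "j = 2" | "j = 3" using j less4 by auto
      then show ?thesis
      proof cases
        case 1 then show ?thesis using g by (auto simp: W)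
      next
        case 2
        have "AE \<omega> in M. \<bar>real_of_int (\<xi> n v \<omega>)\<bar> \<le> 1"
          using AE_good
        proof eventually_elim
          case (elim \<omega>)
          show ?case using goodD(1)[OF elim n v] by linarith
        qed
        then show ?thesis using 2 by (auto simp: W)
      qed (auto simp: W intro!: exI[of _ 1])
    qed
    then show ?thesis using integrable_const_bound rv[OF j] by blast
  qed
  have h: "h = (\<lambda>\<omega>. \<Prod>j\<in>{..<4}. W j \<omega>)"
    unfolding h_def less4 by (simp add: W)
  show "integrable M h"
    unfolding h by (rule indep_vars_integrable[OF _ ind int]) auto
  have "expectation h = (\<Prod>j\<in>{..<4}. expectation (W j))"
    unfolding h by (rule indep_vars_lebesgue_integral[OF _ ind int]) auto
  also have "\<dots> = expectation (W 0) * (expectation (W 1) * (expectation (W 2) * expectation (W 3)))"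
    unfolding less4 by simp
  also have "expectation (W 1) = measure_pmf.expectation (rad_pmf (p v)) of_int"
    unfolding W using n v by (intro expectation_of_law xi_law) auto
  also have "\<dots> = 2 * p v - 1"
    using p_range[OF v] by (simp add: rad_pmf_def)
  also have "expectation (W 2) = measure_pmf.expectation (pmf_of_set {1..n}) (\<lambda>x. of_bool (x = d))"
    unfolding W using n v by (intro expectation_of_law[where h = "\<lambda>x. of_bool (x = d)"] D_law) auto
  also have "\<dots> = 1 / real n"
    using n d by (subst integral_pmf_of_set) (auto simp: of_bool_def sum.delta)
  also have "expectation (W 3) = measure_pmf.expectation (pmf_of_set (in_nbrs E v)) (\<lambda>x. of_bool (x = i))"
    unfolding W using n v by (intro expectation_of_law[where h = "\<lambda>x. of_bool (x = i)"] u_law) auto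
  also have "\<dots> = 1 / real (card (in_nbrs E v))"
    using i v in_nbrs_nonempty finite_in_nbrs
    by (subst integral_pmf_of_set) (auto simp: of_bool_def sum.delta)
  finally show "expectation h = expectation (\<lambda>\<omega>. g (past n \<omega>)) *
      ((2 * p v - 1) / (real n * real (card (in_nbrs E v))))"
    by (simp add: W)
qed


section \<open>Martingale differences of the walk\<close>

definition weight :: "nat \<Rightarrow> nat \<Rightarrow> real" where
  "weight i v = (if (i, v) \<in> E then (2 * p v - 1) / real (card (in_nbrs E v)) else 0)"

text \<open>The step minus its conditional mean \<open>S n B / n\<close>. With the path as an
  argument the formula serves both the walk itself and its measurable version.\<close>

definition incr :: "(nat \<Rightarrow> nat \<Rightarrow> int) \<Rightarrow> nat \<Rightarrow> nat \<Rightarrow> real" where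
  "incr x n v = x (Suc n) v - (\<Sum>i<k. (\<Sum>j=1..n. x j i) * weight i v) / real n"

text \<open>The sum stops before \<open>n\<close>, so it involves only steps up to time
  \<open>n\<close> and is 0 at \<open>n = 1\<close>; the first step is not centred.\<close>

definition mart :: "(nat \<Rightarrow> nat \<Rightarrow> int) \<Rightarrow> nat \<Rightarrow> nat \<Rightarrow> real" where
  "mart x n v = (\<Sum>l\<in>{1..<n}. incr x l v)"

abbreviation walk_path :: "'a \<Rightarrow> nat \<Rightarrow> nat \<Rightarrow> int" where
  "walk_path \<omega> \<equiv> (\<lambda>j i. X j i \<omega>)"

abbreviation past_path :: "nat \<Rightarrow> 'a \<Rightarrow> nat \<Rightarrow> nat \<Rightarrow> int" where
  "past_path n \<omega> \<equiv> (\<lambda>j i. path_step j i (past n \<omega>))"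

lemma incr_cong:
  assumes "v < k" "\<And>j i. j \<le> Suc n \<Longrightarrow> i < k \<Longrightarrow> x j i = x' j i"
  shows "incr x n v = incr x' n v"
proof -
  have "(\<Sum>i<k. (\<Sum>j=1..n. real_of_int (x j i)) * weight i v) =
      (\<Sum>i<k. (\<Sum>j=1..n. real_of_int (x' j i)) * weight i v)"
    using assms(2) by (intro sum.cong refl arg_cong2[of _ _ _ _ "(*)"] arg_cong[of _ _ real_of_int]) auto
  then show ?thesis using assms by (simp add: incr_def)
qed

lemma mart_cong:
  assumes "v < k" "\<And>j i. j \<le> n \<Longrightarrow> i < k \<Longrightarrow> x j i = x' j i"
  shows "mart x n v = mart x' n v"
  unfolding mart_def using assms by (intro sum.cong incr_cong) auto

lemma mart_Suc: "1 \<le> n \<Longrightarrow> mart x (Suc n) v = mart x n v + incr x n v"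
  by (simp add: mart_def)

lemma sum_weight:
  assumes "v < k"
  shows "(\<Sum>i<k. a i * weight i v) =
    (\<Sum>i\<in>in_nbrs E v. a i * ((2 * p v - 1) / real (card (in_nbrs E v))))"
proof -
  have "(\<Sum>i<k. a i * weight i v) = (\<Sum>i\<in>in_nbrs E v. a i * weight i v)"
    by (rule sum.mono_neutral_right) (use in_nbrs_subset in \<open>auto simp: weight_def in_nbrs_def\<close>)
  also have "\<dots> = (\<Sum>i\<in>in_nbrs E v. a i * ((2 * p v - 1) / real (card (in_nbrs E v))))"
    by (intro sum.cong) (auto simp: weight_def in_nbrs_def)
  finally show ?thesis .
qed

text \<open>Steps have modulus at most 1. So has the drift: it sums over in-degree many neighbours,
  with weights at most 1 over the in-degree and walk coordinates at most \<open>n\<close>.\<close>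

lemma abs_incr_le:
  assumes "good \<omega>" "v < k"
  shows "\<bar>incr (walk_path \<omega>) n v\<bar> \<le> 2"
proof -
  let ?c = "real (card (in_nbrs E v))"
  have c: "0 < ?c" using indegree_pos[OF assms(2)] by simp
  have "\<bar>\<Sum>i<k. (\<Sum>j=1..n. real_of_int (X j i \<omega>)) * weight i v\<bar> \<le>
      (\<Sum>i\<in>in_nbrs E v. \<bar>(\<Sum>j=1..n. real_of_int (X j i \<omega>)) * ((2 * p v - 1) / ?c)\<bar>)"
    unfolding sum_weight[OF assms(2)] by (rule sum_abs)
  also have "\<dots> \<le> (\<Sum>i\<in>in_nbrs E v. real n * (1 / ?c))"
  proof (intro sum_mono)
    fix i assume "i \<in> in_nbrs E v"
    then have i: "i < k" using in_nbrs_subset by auto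
    have "\<bar>real_of_int (X j i \<omega>)\<bar> \<le> 1" for j using abs_X_le[OF assms(1) i, of j] by linarith
    then have "\<bar>\<Sum>j=1..n. real_of_int (X j i \<omega>)\<bar> \<le> (\<Sum>j=1..n. 1)"
      by (intro order_trans[OF sum_abs] sum_mono)
    then have "\<bar>\<Sum>j=1..n. real_of_int (X j i \<omega>)\<bar> \<le> real n" by simp
    moreover have "\<bar>2 * p v - 1\<bar> \<le> 1" using p_range[OF assms(2)] by auto
    then have "\<bar>(2 * p v - 1) / ?c\<bar> \<le> 1 / ?c"
      unfolding abs_divide using c by (intro frac_le) auto
    ultimately show "\<bar>(\<Sum>j=1..n. real_of_int (X j i \<omega>)) * ((2 * p v - 1) / ?c)\<bar> \<le> real n * (1 / ?c)"
      unfolding abs_mult by (intro mult_mono) auto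
  qed
  also have "\<dots> = real n" using c by simp
  finally have "\<bar>(\<Sum>i<k. (\<Sum>j=1..n. real_of_int (X j i \<omega>)) * weight i v) / real n\<bar> \<le> 1"
    by (cases "n = 0") (auto simp: abs_divide)
  moreover have "\<bar>real_of_int (X (Suc n) v \<omega>)\<bar> \<le> 1"
    using abs_X_le[OF assms, of "Suc n"] by linarith
  ultimately show ?thesis unfolding incr_def by linarith
qed

text \<open>Summing over all memory times and neighbours writes the increment as old steps times
  centred fresh noise, the form to which \<open>step_expectation\<close> applies.\<close>

lemma incr_expand:
  assumes \<omega>: "good \<omega>" and n: "1 \<le> n" and v: "v < k"
  shows "incr (walk_path \<omega>) n v = (\<Sum>i\<in>in_nbrs E v. \<Sum>d=1..n. X d i \<omega> *
    (\<xi> n v \<omega> * (of_bool (D n v \<omega> = d) * of_bool (u n v \<omega> = i)) -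
     (2 * p v - 1) / (real n * real (card (in_nbrs E v)))))"
proof -
  obtain m where m: "n = Suc m" using n by (cases n) auto
  note g = goodD[OF \<omega> n v]
  let ?f = "\<lambda>i d. real_of_int (X d i \<omega> * \<xi> n v \<omega>)"
  have "(\<Sum>i\<in>in_nbrs E v. \<Sum>d=1..n. ?f i d * (of_bool (D n v \<omega> = d) * of_bool (u n v \<omega> = i))) =
      (\<Sum>i\<in>in_nbrs E v. if u n v \<omega> = i then ?f i (D n v \<omega>) else 0)"
  proof (intro sum.cong refl)
    fix i
    have "(\<Sum>d=1..n. ?f i d * (of_bool (D n v \<omega> = d) * of_bool (u n v \<omega> = i))) =
        (\<Sum>d=1..n. if D n v \<omega> = d then ?f i d * of_bool (u n v \<omega> = i) else 0)"
      by (intro sum.cong) auto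
    then show "(\<Sum>d=1..n. ?f i d * (of_bool (D n v \<omega> = d) * of_bool (u n v \<omega> = i))) =
        (if u n v \<omega> = i then ?f i (D n v \<omega>) else 0)"
      using g by (simp add: sum.delta')
  qed
  also have "\<dots> = ?f (u n v \<omega>) (D n v \<omega>)"
    using g finite_in_nbrs by (simp add: sum.delta')
  also have "\<dots> = real_of_int (X (Suc n) v \<omega>)"
    using g unfolding m by simp
  finally have 1: "real_of_int (X (Suc n) v \<omega>) =
      (\<Sum>i\<in>in_nbrs E v. \<Sum>d=1..n. ?f i d * (of_bool (D n v \<omega> = d) * of_bool (u n v \<omega> = i)))" ..
  have 2: "(\<Sum>i<k. (\<Sum>j=1..n. real_of_int (X j i \<omega>)) * weight i v) / real n =
      (\<Sum>i\<in>in_nbrs E v. \<Sum>d=1..n. real_of_int (X d i \<omega>) * ((2 * p v - 1) / (real n * real (card (in_nbrs E v)))))"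
    unfolding sum_weight[OF v]
    unfolding sum_divide_distrib sum_distrib_right
    by (intro sum.cong refl) simp
  show ?thesis
    unfolding incr_def 1 2 by (simp add: right_diff_distrib sum_subtractf mult.assoc del: times_divide_eq_right)
qed

text \<open>The martingale property, tested against bounded functions of the past. In each term of
  \<open>incr_expand\<close> the old step is absorbed into the test function \<open>G\<close>; the
  two resulting products have equal expectations.\<close>

lemma incr_orthogonal:
  fixes g :: "(noise_index \<Rightarrow> int) \<Rightarrow> real"
  assumes n: "1 \<le> n" and v: "v < k" and g: "AE \<omega> in M. \<bar>g (past n \<omega>)\<bar> \<le> C"
  shows "expectation (\<lambda>\<omega>. g (past n \<omega>) * incr (past_path (Suc n) \<omega>) n v) = 0"
proof -
  define G where "G = (\<lambda>d i z. g z * real_of_int (path_step d i z))"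
  let ?c = "(2 * p v - 1) / (real n * real (card (in_nbrs E v)))"
  let ?ind = "\<lambda>d i \<omega>. real_of_int (\<xi> n v \<omega>) * (of_bool (D n v \<omega> = d) * of_bool (u n v \<omega> = i))"
  have G: "AE \<omega> in M. \<bar>G d i (past n \<omega>)\<bar> \<le> C" if "d \<in> {1..n}" "i \<in> in_nbrs E v" for d i
    using g AE_good
  proof eventually_elim
    case (elim \<omega>)
    have "i < k" using that in_nbrs_subset by auto
    then have "\<bar>path_step d i (past n \<omega>)\<bar> \<le> 1"
      using that elim by (simp add: path_step_past abs_X_le)
    then have "\<bar>g (past n \<omega>)\<bar> * \<bar>real_of_int (path_step d i (past n \<omega>))\<bar> \<le> C * 1"
      using elim by (intro mult_mono) linarith+
    then show ?case by (simp add: G_def abs_mult)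
  qed
  have int: "integrable M (\<lambda>\<omega>. G d i (past n \<omega>))" if "d \<in> {1..n}" "i \<in> in_nbrs E v" for d i
    using G[OF that] by (intro integrable_const_bound[of _ C] measurable_past) auto
  note step = step_expectation[OF n v _ _ G]
  have "expectation (\<lambda>\<omega>. g (past n \<omega>) * incr (past_path (Suc n) \<omega>) n v) =
      expectation (\<lambda>\<omega>. \<Sum>i\<in>in_nbrs E v. \<Sum>d=1..n. G d i (past n \<omega>) * ?ind d i \<omega> - G d i (past n \<omega>) * ?c)"
  proof (rule integral_cong_AE)
    show "(\<lambda>\<omega>. g (past n \<omega>) * incr (past_path (Suc n) \<omega>) n v) \<in> borel_measurable M"
      by (intro borel_measurable_times measurable_past
          measurable_past[where g = "\<lambda>z. incr (\<lambda>j i. path_step j i z) n v"])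
    show "(\<lambda>\<omega>. \<Sum>i\<in>in_nbrs E v. \<Sum>d=1..n. G d i (past n \<omega>) * ?ind d i \<omega> - G d i (past n \<omega>) * ?c)
        \<in> borel_measurable M"
      using step(1) int by (intro borel_measurable_sum borel_measurable_diff borel_measurable_integrable
          integrable_mult_left) auto
    show "AE \<omega> in M. g (past n \<omega>) * incr (past_path (Suc n) \<omega>) n v =
        (\<Sum>i\<in>in_nbrs E v. \<Sum>d=1..n. G d i (past n \<omega>) * ?ind d i \<omega> - G d i (past n \<omega>) * ?c)"
      using AE_good
    proof eventually_elim
      case (elim \<omega>)
      have "incr (past_path (Suc n) \<omega>) n v = incr (walk_path \<omega>) n v"
        using elim v by (intro incr_cong) (auto simp: path_step_past)
      also have "\<dots> = (\<Sum>i\<in>in_nbrs E v. \<Sum>d=1..n. path_step d i (past n \<omega>) * (?ind d i \<omega> - ?c))"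
        unfolding incr_expand[OF elim n v]
        using elim in_nbrs_subset[of v] by (intro sum.cong refl) (auto simp: path_step_past)
      finally show ?case
        by (simp add: G_def sum_distrib_left right_diff_distrib mult.assoc)
    qed
  qed
  also have "\<dots> = (\<Sum>i\<in>in_nbrs E v. \<Sum>d=1..n. 0)"
  proof (intro has_bochner_integral_integral_eq has_bochner_integral_sum)
    fix i d assume id: "i \<in> in_nbrs E v" "d \<in> {1..n}"
    have "has_bochner_integral M (\<lambda>\<omega>. G d i (past n \<omega>) * ?ind d i \<omega>) (expectation (\<lambda>\<omega>. G d i (past n \<omega>)) * ?c)"
      using step[OF id(2) id(1) id(2) id(1)] by (simp add: has_bochner_integral_iff)
    moreover have "has_bochner_integral M (\<lambda>\<omega>. G d i (past n \<omega>) * ?c) (expectation (\<lambda>\<omega>. G d i (past n \<omega>)) * ?c)"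
      using int[OF id(2,1)] by (intro has_bochner_integral_mult_left) (simp add: has_bochner_integral_iff)
    ultimately have "has_bochner_integral M (\<lambda>\<omega>. G d i (past n \<omega>) * ?ind d i \<omega> - G d i (past n \<omega>) * ?c)
        (expectation (\<lambda>\<omega>. G d i (past n \<omega>)) * ?c - expectation (\<lambda>\<omega>. G d i (past n \<omega>)) * ?c)"
      by (rule has_bochner_integral_diff)
    then show "has_bochner_integral M (\<lambda>\<omega>. G d i (past n \<omega>) * ?ind d i \<omega> - G d i (past n \<omega>) * ?c) 0"
      by simp
  qed
  finally show ?thesis by simp
qed

section \<open>Exponential moments and almost sure growth of the martingale\<close>

lemma abs_mart_le:
  assumes "good \<omega>" "v < k"
  shows "\<bar>mart (walk_path \<omega>) n v\<bar> \<le> 2 * real n"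
proof -
  have "\<bar>mart (walk_path \<omega>) n v\<bar> \<le> (\<Sum>l\<in>{1..<n}. 2)"
    unfolding mart_def using abs_incr_le[OF assms] by (intro order_trans[OF sum_abs] sum_mono)
  then show ?thesis by simp
qed

lemma mart_past:
  assumes "good \<omega>" "v < k" "n \<le> m"
  shows "mart (past_path m \<omega>) n v = mart (walk_path \<omega>) n v"
  using assms by (intro mart_cong) (auto simp: path_step_past)

lemma exp_mart_bounded:
  assumes "v < k" "n \<le> m"
  shows "AE \<omega> in M. \<bar>exp (s * mart (past_path m \<omega>) n v)\<bar> \<le> exp (\<bar>s\<bar> * (2 * real n))"
  using AE_good
proof eventually_elim
  case (elim \<omega>)
  have "s * mart (walk_path \<omega>) n v \<le> \<bar>s\<bar> * \<bar>mart (walk_path \<omega>) n v\<bar>"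
    by (metis abs_ge_self abs_mult)
  also have "\<dots> \<le> \<bar>s\<bar> * (2 * real n)" using abs_mart_le[OF elim assms(1)] by (intro mult_left_mono) auto
  finally show ?case using elim assms by (simp add: mart_past)
qed

lemma integrable_exp_mart:
  assumes "v < k" "n \<le> m"
  shows "integrable M (\<lambda>\<omega>. exp (s * mart (past_path m \<omega>) n v))"
  using exp_mart_bounded[OF assms, of s]
  by (intro integrable_const_bound measurable_past[where g = "\<lambda>z. exp (s * mart (\<lambda>j i. path_step j i z) n v)"])
    auto

text \<open>Azuma--Hoeffding by induction. The bound on \<open>s\<close> keeps \<open>s\<close>
  times an increment in [-1, 1], where \<open>exp_le_quadratic\<close> applies; orthogonality
  removes the linear term, so each step costs a factor
  \<open>1 + 4 * s^2 \<le> exp (4 * s^2)\<close>.\<close>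

lemma exp_mart_le:
  assumes v: "v < k" and s: "\<bar>s\<bar> \<le> 1 / 2"
  shows "expectation (\<lambda>\<omega>. exp (s * mart (past_path n \<omega>) n v)) \<le> exp (4 * s\<^sup>2 * real n)"
proof (induction n)
  case 0
  show ?case by (simp add: mart_def prob_space)
next
  case (Suc n)
  show ?case
  proof (cases "n = 0")
    case True
    then show ?thesis by (simp add: mart_def prob_space)
  next
    case False
    then have n: "1 \<le> n" by simp
    define g where "g = (\<lambda>z. exp (s * mart (\<lambda>j i. path_step j i z) n v))"
    let ?I = "\<lambda>\<omega>. incr (past_path (Suc n) \<omega>) n v"
    have gb: "AE \<omega> in M. \<bar>g (past n \<omega>)\<bar> \<le> exp (\<bar>s\<bar> * (2 * real n))"
      unfolding g_def using exp_mart_bounded[OF v, of n n s] by simp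
    have gi: "integrable M (\<lambda>\<omega>. g (past n \<omega>))"
      unfolding g_def using integrable_exp_mart[OF v, of n n s] by simp
    have gI: "integrable M (\<lambda>\<omega>. g (past n \<omega>) * ?I \<omega>)"
    proof (rule integrable_const_bound)
      show "AE \<omega> in M. norm (g (past n \<omega>) * ?I \<omega>) \<le> exp (\<bar>s\<bar> * (2 * real n)) * 2"
        using gb AE_good
      proof eventually_elim
        case (elim \<omega>)
        have "?I \<omega> = incr (walk_path \<omega>) n v"
          using elim v by (intro incr_cong) (auto simp: path_step_past)
        then show ?case
          using elim abs_incr_le[OF elim(2) v, of n] by (auto simp: abs_mult intro!: mult_mono)
      qed
      show "(\<lambda>\<omega>. g (past n \<omega>) * ?I \<omega>) \<in> borel_measurable M"
        by (intro borel_measurable_times measurable_past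
            measurable_past[where g = "\<lambda>z. incr (\<lambda>j i. path_step j i z) n v"])
    qed
    have "expectation (\<lambda>\<omega>. exp (s * mart (past_path (Suc n) \<omega>) (Suc n) v)) \<le>
        expectation (\<lambda>\<omega>. (1 + 4 * s\<^sup>2) * g (past n \<omega>) + s * (g (past n \<omega>) * ?I \<omega>))"
    proof (rule integral_mono_AE)
      show "AE \<omega> in M. exp (s * mart (past_path (Suc n) \<omega>) (Suc n) v) \<le>
          (1 + 4 * s\<^sup>2) * g (past n \<omega>) + s * (g (past n \<omega>) * ?I \<omega>)"
        using AE_good
      proof eventually_elim
        case (elim \<omega>)
        have I: "?I \<omega> = incr (walk_path \<omega>) n v"
          using elim v by (intro incr_cong) (auto simp: path_step_past)
        have Ile: "\<bar>?I \<omega>\<bar> \<le> 2" unfolding I by (rule abs_incr_le[OF elim v])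
        have "\<bar>s * ?I \<omega>\<bar> \<le> 1 / 2 * 2"
          unfolding abs_mult using s Ile by (intro mult_mono) auto
        then have "exp (s * ?I \<omega>) \<le> 1 + s * ?I \<omega> + (s * ?I \<omega>)\<^sup>2"
          by (intro exp_le_quadratic) simp
        also have "(s * ?I \<omega>)\<^sup>2 \<le> s\<^sup>2 * 4"
        proof -
          have "(?I \<omega>)\<^sup>2 \<le> 2\<^sup>2" using Ile by (metis abs_numeral abs_le_square_iff)
          then show ?thesis unfolding power_mult_distrib by (intro mult_left_mono) auto
        qed
        finally have le: "exp (s * ?I \<omega>) \<le> (1 + 4 * s\<^sup>2) + s * ?I \<omega>" by simp
        \<comment> \<open>Lengthening the recorded past does not change the martingale at time
          \<open>n\<close> on a good path.\<close>
        have "mart (past_path (Suc n) \<omega>) (Suc n) v = mart (past_path n \<omega>) n v + ?I \<omega>"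
          using mart_past[OF elim v, of n n] mart_past[OF elim v, of n "Suc n"] mart_Suc[OF n] by simp
        then have "exp (s * mart (past_path (Suc n) \<omega>) (Suc n) v) = g (past n \<omega>) * exp (s * ?I \<omega>)"
          by (simp add: g_def distrib_left exp_add)
        also have "\<dots> \<le> g (past n \<omega>) * ((1 + 4 * s\<^sup>2) + s * ?I \<omega>)"
          using le by (intro mult_left_mono) (auto simp: g_def)
        finally show ?case by (simp add: algebra_simps)
      qed
    qed (use gi gI integrable_exp_mart[OF v, of "Suc n" "Suc n" s] in auto)
    also have "\<dots> = (1 + 4 * s\<^sup>2) * expectation (\<lambda>\<omega>. g (past n \<omega>))"
      using gi gI incr_orthogonal[OF n v gb] by simp
    also have "\<dots> \<le> exp (4 * s\<^sup>2) * exp (4 * s\<^sup>2 * real n)"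
      using Suc.IH exp_ge_add_one_self[of "4 * s\<^sup>2"]
      by (intro mult_mono) (auto simp: g_def intro!: integral_nonneg_AE)
    also have "\<dots> = exp (4 * s\<^sup>2 * real (Suc n))" by (simp add: algebra_simps flip: exp_add)
    finally show ?thesis .
  qed
qed

text \<open>An exponential Markov bound at each time, then Borel--Cantelli: as
  \<open>\<beta> > 1 / 2\<close>, the tail bound is a stretched exponential in \<open>n\<close>,
  hence summable.\<close>

lemma mart_growth:
  assumes v: "v < k" and \<beta>: "1 / 2 < \<beta>"
  shows "AE \<omega> in M. eventually (\<lambda>n. \<bar>mart (walk_path \<omega>) n v\<bar> \<le> real n powr \<beta>) sequentially"
proof -
  \<comment> \<open>With this scaling the exponent \<open>4 * (s n)^2 * n\<close> of
    \<open>exp_mart_le\<close> is at most 1, while the level \<open>n powr \<beta>\<close> becomes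
    \<open>n powr (\<beta> - 1 / 2) / 2\<close>.\<close>
  define s where "s = (\<lambda>n. real n powr (- 1 / 2) / 2)"
  \<comment> \<open>Both signs together control the modulus.\<close>
  define U where "U = (\<lambda>n \<omega>. exp (s n * mart (past_path n \<omega>) n v) + exp (- s n * mart (past_path n \<omega>) n v))"
  define A where "A = (\<lambda>n. {\<omega> \<in> space M. U n \<omega> \<ge> exp (real n powr (\<beta> - 1 / 2) / 2)})"
  have s_le: "\<bar>s n\<bar> \<le> 1 / 2" for n
  proof (cases "n = 0")
    case False
    then have "real n powr (- 1 / 2) \<le> real n powr 0" by (intro powr_mono) auto
    then show ?thesis using False by (simp add: s_def)
  qed (simp add: s_def)
  have s_sq: "4 * (s n)\<^sup>2 * real n \<le> 1" for n
  proof (cases "n = 0")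
    case False
    have "4 * (s n)\<^sup>2 * real n = (real n powr (- 1 / 2) * real n powr (- 1 / 2)) * real n powr 1"
      using False by (simp add: s_def power2_eq_square)
    also have "\<dots> = 1" using False by (simp only: flip: powr_add) simp
    finally show ?thesis by simp
  qed simp
  have U_meas: "U n \<in> borel_measurable M" for n
    unfolding U_def
    by (rule measurable_past[where g = "\<lambda>z. exp (s n * mart (\<lambda>j i. path_step j i z) n v) +
          exp (- s n * mart (\<lambda>j i. path_step j i z) n v)"])
  have A_sets: "A n \<in> sets M" for n
    unfolding A_def using U_meas by measurable
  have U_int: "integrable M (U n)" for n
    unfolding U_def by (intro Bochner_Integration.integrable_add integrable_exp_mart v order_refl)
  have U_exp: "expectation (U n) \<le> 2 * exp 1" for n
  proof -
    have "expectation (U n) = expectation (\<lambda>\<omega>. exp (s n * mart (past_path n \<omega>) n v)) +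
        expectation (\<lambda>\<omega>. exp (- s n * mart (past_path n \<omega>) n v))"
      unfolding U_def by (intro Bochner_Integration.integral_add integrable_exp_mart v order_refl)
    also have "\<dots> \<le> exp (4 * (s n)\<^sup>2 * real n) + exp (4 * (- s n)\<^sup>2 * real n)"
      using s_le[of n] by (intro add_mono exp_mart_le v) auto
    also have "\<dots> \<le> exp 1 + exp 1"
      using s_sq[of n] by (intro add_mono) auto
    finally show ?thesis by simp
  qed
  have A_prob: "prob (A n) \<le> 2 * exp 1 * exp (- (real n powr (\<beta> - 1 / 2) / 2))" for n
  proof -
    have "emeasure M (A n) \<le> ennreal (1 / exp (real n powr (\<beta> - 1 / 2) / 2) * expectation (U n))"
      unfolding A_def by (rule integral_Markov_inequality[OF U_int]) (auto simp: U_def add_nonneg_nonneg)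
    then have "prob (A n) \<le> 1 / exp (real n powr (\<beta> - 1 / 2) / 2) * expectation (U n)"
      by (simp add: emeasure_eq_measure U_def integral_nonneg_AE add_nonneg_nonneg)
    also have "\<dots> \<le> 1 / exp (real n powr (\<beta> - 1 / 2) / 2) * (2 * exp 1)"
      using U_exp by (intro mult_left_mono) auto
    finally show ?thesis by (simp add: exp_minus inverse_eq_divide)
  qed
  have "summable (\<lambda>n. prob (A n))"
  proof (rule summable_comparison_test_ev)
    have "eventually (\<lambda>n. 2 * exp 1 * exp (- (real n powr (\<beta> - 1 / 2) / 2)) \<le> real n powr (-2)) sequentially"
      using \<beta> by real_asymp
    then show "eventually (\<lambda>n. norm (prob (A n)) \<le> real n powr (-2)) sequentially"
      by eventually_elim (use A_prob in \<open>auto intro: order_trans\<close>)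
    show "summable (\<lambda>n. real n powr (-2))" by (simp add: summable_real_powr_iff)
  qed
  then have "AE \<omega> in M. eventually (\<lambda>n. \<omega> \<in> space M - A n) sequentially"
    by (intro borel_cantelli_AE1 A_sets) (auto simp: emeasure_eq_measure)
  then show ?thesis
    using AE_good
  proof eventually_elim
    case (elim \<omega>)
    show ?case
      using elim(1) eventually_gt_at_top[of 0]
    proof eventually_elim
      case (elim n)
      define m where "m = mart (walk_path \<omega>) n v"
      have m: "mart (past_path n \<omega>) n v = m"
        unfolding m_def using mart_past[OF \<open>good \<omega>\<close> v] by simp
      have "exp (s n * \<bar>m\<bar>) \<le> U n \<omega>"
        unfolding U_def m by (cases "0 \<le> m") (auto intro: add_increasing add_increasing2)
      also have "\<dots> < exp (real n powr (\<beta> - 1 / 2) / 2)"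
        using elim unfolding A_def by auto
      finally have "s n * \<bar>m\<bar> < real n powr (\<beta> - 1 / 2) / 2" by simp
      also have "\<dots> = s n * real n powr \<beta>"
        unfolding s_def by (simp add: powr_diff powr_minus_divide)
      finally show ?case using elim(2) by (simp add: m_def s_def)
    qed
  qed
qed

end

section \<open>The limit theorem\<close>

theorem theorem14:
  fixes M :: "'a measure" and k :: nat and E :: "(nat \<times> nat) set" and p q :: "nat \<Rightarrow> real"
    and \<sigma> :: "nat \<Rightarrow> 'a \<Rightarrow> int" and \<xi> :: "nat \<Rightarrow> nat \<Rightarrow> 'a \<Rightarrow> int"
    and D u :: "nat \<Rightarrow> nat \<Rightarrow> 'a \<Rightarrow> nat"
    and B H T Tinv :: "complex mat" and \<eta> :: real
    and s :: nat and lam :: "nat \<Rightarrow> complex" and J :: "nat \<Rightarrow> complex mat"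
    and nu_of :: "nat \<Rightarrow> nat" and \<nu> :: nat and e :: "nat \<Rightarrow> complex vec"
  assumes erwg: "erwg M k E p q \<sigma> \<xi> D u"
    and B: "B = memory_matrix k E p"
    and eta: "\<eta> = max_Re_eigenvalue B"
    and eta_range: "1/2 < \<eta>" "\<eta> < 1"
    and lam_distinct: "inj_on lam {..<s}"
    and lam_all: "lam ` {..<s} = spectrum B"
    and H: "H = 1\<^sub>m k - B"
    and T: "T \<in> carrier_mat k k" "Tinv \<in> carrier_mat k k"
      "T * Tinv = 1\<^sub>m k" "Tinv * T = 1\<^sub>m k"
    and J_part: "\<And>t. t < s \<Longrightarrow> is_jordan_part (1 - lam t) (J t)"
    and J_dim: "\<And>t. t < s \<Longrightarrow> J t \<in> carrier_mat (nu_of t) (nu_of t)"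
    and jordan_form: "Tinv * H * T = diag_block_mat (map J [0..<s])"
    and nu: "\<nu> = Max {nu_of t | t. t < s \<and> Re (lam t) = \<eta>}"
    and e: "\<And>t. t < s \<Longrightarrow> e t = unit_vec k ((\<Sum>j\<le>t. nu_of j) - 1)"
  shows "\<exists>\<Xi> :: nat \<Rightarrow> 'a \<Rightarrow> complex.
    (\<forall>t<s. \<Xi> t \<in> borel_measurable M) \<and>
    (AE \<omega> in M. \<forall>v<k.
      (\<lambda>n. of_int (erwg_walk \<sigma> \<xi> D u n v \<omega>)
              / complex_of_real (real n powr \<eta> * ln (real n) ^ (\<nu> - 1))
           - (\<Sum>t | t < s \<and> Re (lam t) = \<eta> \<and> nu_of t = \<nu>.
                exp (\<i> * complex_of_real (Im (lam t) * ln (real n))) * \<Xi> t \<omega>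
                  * row_mult (e t) Tinv $ v))
      \<longlonglongrightarrow> 0)"
proof -
  interpret erwg M k E p q \<sigma> \<xi> D u by (rule erwg)
  define Jf where "Jf = diag_block_mat (map J [0..<s])"
  have B_carrier: "B \<in> carrier_mat k k" by (simp add: B memory_matrix_def)
  have Jf_carrier: "Jf \<in> carrier_mat k k"
    using T B_carrier unfolding Jf_def jordan_form[symmetric] H by auto
  \<comment> \<open>\<open>T * Tinv = 1\<close> turns the conjugation into
    \<open>T * Jf = H * T\<close>.\<close>
  have BT: "B * T = T - T * Jf"
  proof -
    have H_carrier: "H \<in> carrier_mat k k" unfolding H using B_carrier by (rule minus_carrier_mat)
    have "T * Jf = T * (Tinv * (H * T))"
      unfolding Jf_def jordan_form[symmetric] assoc_mult_mat[OF T(2) H_carrier T(1)] ..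
    also have "\<dots> = (T * Tinv) * (H * T)"
      by (rule assoc_mult_mat[OF T(1,2), symmetric]) (use T H_carrier in auto)
    also have "\<dots> = H * T"
      unfolding T(3) by (rule left_mult_one_mat) (use T H_carrier in auto)
    also have "\<dots> = 1\<^sub>m k * T - B * T"
      unfolding H by (rule minus_mult_distrib_mat) (use T B_carrier in auto)
    also have "1\<^sub>m k * T = T" by (rule left_mult_one_mat[OF T(1)])
    finally show ?thesis using T B_carrier by (intro eq_matI) auto
  qed
  have fin: "finite (spectrum B)" using card_finite_spectrum[OF B_carrier] by simp
  have Re_le: "Re (lam t) \<le> \<eta>" if "t < s" for t
    unfolding eta max_Re_eigenvalue_def using fin lam_all that by (intro Max_ge) auto
  have nu_le: "nu_of t \<le> \<nu>" if "t < s" "Re (lam t) = \<eta>" for t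
    unfolding nu using that by (intro Max_ge) (auto simp: setcompr_eq_image)
  \<comment> \<open>The midpoint of 1/2 and \<open>\<eta>\<close>: \<open>mart_growth\<close> needs
    an exponent above 1/2, the deterministic analysis one below \<open>\<eta>\<close>.\<close>
  define \<beta> where "\<beta> = (1 / 2 + \<eta>) / 2"
  have \<beta>: "1 / 2 < \<beta>" "\<beta> < \<eta>" using eta_range by (auto simp: \<beta>_def field_simps)
  define walk :: "(nat \<Rightarrow> nat \<Rightarrow> int) \<Rightarrow> nat \<Rightarrow> nat \<Rightarrow> complex" where
    "walk = (\<lambda>x n v. of_int (\<Sum>j=1..n. x j v))"
  \<comment> \<open>The limit functional of \<open>jordan_system\<close> for an arbitrary path,
    stated here because that locale is interpreted only for a fixed \<open>\<omega>\<close>.\<close>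
  define \<Theta> :: "(nat \<Rightarrow> nat \<Rightarrow> complex) \<Rightarrow> nat \<Rightarrow> complex" where
    "\<Theta> = (\<lambda>S t. if \<nu> = 0 then 0 else lim (\<lambda>n. (\<Sum>v<k. S n v * T $$ (v, (\<Sum>j\<le>t. nu_of j) - 1)) /
       (exp (lam t * of_real (ln (real n))) * of_real (ln (real n) ^ (\<nu> - 1)))))"
  \<comment> \<open>Along \<open>past_path\<close> every term of the sequence is measurable, so
    \<open>Z t\<close> is measurable on the whole space; on good paths it is the limit taken along
    the walk itself.\<close>
  define Z where "Z = (\<lambda>t \<omega>. \<Theta> (\<lambda>n. walk (past_path n \<omega>) n) t)"
  have "Z t \<in> borel_measurable M" for t
  proof -
    have "(\<lambda>\<omega>. walk (past_path n \<omega>) n v) \<in> borel_measurable M" for n v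
      by (rule measurable_past[where g = "\<lambda>z. walk (\<lambda>j i. path_step j i z) n v"])
    then show ?thesis unfolding Z_def \<Theta>_def by (cases "\<nu> = 0") simp_all
  qed
  moreover have "AE \<omega> in M. \<forall>v<k.
      (\<lambda>n. of_int (erwg_walk \<sigma> \<xi> D u n v \<omega>)
              / complex_of_real (real n powr \<eta> * ln (real n) ^ (\<nu> - 1))
           - (\<Sum>t | t < s \<and> Re (lam t) = \<eta> \<and> nu_of t = \<nu>.
                exp (\<i> * complex_of_real (Im (lam t) * ln (real n))) * Z t \<omega>
                  * row_mult (e t) Tinv $ v))
      \<longlonglongrightarrow> 0"
  proof -
    have "AE \<omega> in M. \<forall>v\<in>{..<k}. eventually (\<lambda>n. \<bar>mart (walk_path \<omega>) n v\<bar> \<le> real n powr \<beta>) sequentially"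
      using mart_growth[OF _ \<beta>(1)] by (intro AE_finite_allI) auto
    then show ?thesis
      using AE_good
    proof eventually_elim
      case (elim \<omega>)
      define S where "S = (\<lambda>n v. walk (walk_path \<omega>) n v)"
      define N :: "nat \<Rightarrow> nat \<Rightarrow> complex" where "N = (\<lambda>n v. of_real (mart (walk_path \<omega>) n v))"
      \<comment> \<open>For this fixed \<open>\<omega>\<close> the argument is deterministic: the
        recursion is the definition of \<open>incr\<close>, and the growth bound comes from
        \<open>mart_growth\<close>.\<close>
      interpret jordan_system k B T Tinv Jf S N \<eta> \<beta> s lam J nu_of \<nu>
      proof
        fix n v :: nat assume n: "1 \<le> n" and v: "v < k"
        have weight: "B $$ (i, v) = of_real (weight i v)" if "i < k" for i
          using that v by (simp add: B memory_matrix_def weight_def)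
        have "(\<Sum>i<k. S n i * B $$ (i, v)) = of_real (\<Sum>i<k. (\<Sum>j=1..n. X j i \<omega>) * weight i v)"
          by (simp add: weight S_def walk_def)
        then have "N (Suc n) v - N n v = of_int (X (Suc n) v \<omega>) - (\<Sum>i<k. S n i * B $$ (i, v)) / of_nat n"
          using mart_Suc[OF n] by (simp add: N_def incr_def)
        moreover have "S (Suc n) v = S n v + of_int (X (Suc n) v \<omega>)"
          by (simp add: S_def walk_def)
        ultimately show "S (Suc n) v = S n v + (\<Sum>i<k. S n i * B $$ (i, v)) / of_nat n + (N (Suc n) v - N n v)"
          by simp
      next
        fix v assume "v < k"
        then show "eventually (\<lambda>n. norm (N n v) \<le> real n powr \<beta>) sequentially"
          using elim(1) by (simp add: N_def)
      qed (use T B_carrier Jf_carrier BT eta_range \<beta> Re_le nu_le J_part J_dim in \<open>simp_all add: Jf_def\<close>)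
      have "walk (past_path n \<omega>) n v = S n v" if "v < k" for n v
        using that elim(2) by (simp add: S_def walk_def path_step_past)
      then have "Z t \<omega> = \<Theta> S t" for t
        by (simp add: Z_def \<Theta>_def)
      then have Z_eq: "Z t \<omega> = \<Xi> t" for t
        by (simp only: \<Theta>_def \<Xi>_def final_def)
      have e_eq: "e t = unit_vec k (final t)" if "t < s" for t
        using e[OF that] by (simp only: final_def)
      have S_eq: "of_int (erwg_walk \<sigma> \<xi> D u n v \<omega>) = S n v" for n v
        by (simp add: S_def walk_def erwg_walk_def)
      show ?case
      proof (intro allI impI)
        fix v assume "v < k"
        from limit[OF this] show "(\<lambda>n. of_int (erwg_walk \<sigma> \<xi> D u n v \<omega>)
              / complex_of_real (real n powr \<eta> * ln (real n) ^ (\<nu> - 1))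
           - (\<Sum>t | t < s \<and> Re (lam t) = \<eta> \<and> nu_of t = \<nu>.
                exp (\<i> * complex_of_real (Im (lam t) * ln (real n))) * Z t \<omega>
                  * row_mult (e t) Tinv $ v))
          \<longlonglongrightarrow> 0"
          unfolding Z_eq S_eq scale_def rotation_def
          by (rule back_subst[of "\<lambda>f. f \<longlonglongrightarrow> 0"], intro ext arg_cong2[of _ _ _ _ "(-)"] sum.cong refl)
            (simp add: e_eq)
      qed
    qed
  qed
  ultimately show ?thesis by blast
qed

end
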